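(* Let $Y$ be a (possibly killed) Lévy process started from $0$ with lifetime $\zeta$ and Laplace exponent $\psi_Y(z)=\ln\mathbb E[e^{zY_1}]$; if $\psi_Y(0)=0$ (no killing), assume also $\mathbb E[Y_1]>0$. Let $I=\int_0^\zeta e^{-Y_t}dt$ and $\mathcal M_Y(s)=\mathbb E[I^{s-1}]$. Assume Cramér's condition: there exists $z_0<0$ such that $\psi_Y(z)$ is finite for all $z\in(z_0,0)$, and $\psi_Y(-\theta)=0$ for some $\theta\in(0,-z_0)$. If a function $f(s)$ satisfies (i) $f$ is analytic and zero-free in the strip $\mathrm{Re}(s)\in(0,1+\theta)$; (ii) $f(1)=1$ and $f(s+1)=-s f(s)/\psi_Y(-s)$ for all $s\in(0,\theta)$; (iii) $|f(s)|^{-1}=o(\exp(2\pi|\mathrm{Im}(s)|))$ as $|\mathrm{Im}(s)|\to\infty$, $\mathrm{Re}(s)\in(0,1+\theta)$; then $\mathcal M_Y(s)\equiv f(s)$ for $\mathrm{Re}(s)\in(0,1+\theta)$.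
   Context: Killing convention: the process is sent to a cemetery state at its lifetime $\zeta$ and $e^{zY_1}=0$ on $\{\zeta\le1\}$, so $\psi_Y(0)<0$ exactly when the process is killed at a positive rate. If there is no killing, $\zeta=+\infty$. *)

theory Defs
  imports "HOL-Probability.Probability"
begin

definition cadlag :: "(real \<Rightarrow> real) \<Rightarrow> bool" where
  "cadlag x \<longleftrightarrow>
     (\<forall>t\<ge>0. (x \<longlongrightarrow> x t) (at_right t)) \<and>
     (\<forall>t>0. \<exists>l. (x \<longlongrightarrow> l) (at_left t))"

text \<open>
  Only times \<open>t \<ge> 0\<close> matter.  All paths, rather than almost all, are cadlag, so that
  path integrals are measurable although the measure space need not be complete.
\<close>
definition levy_process :: "'a measure \<Rightarrow> (real \<Rightarrow> 'a \<Rightarrow> real) \<Rightarrow> bool" where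
  "levy_process M X \<longleftrightarrow>
     prob_space M \<and>
     (\<forall>t\<ge>0. X t \<in> borel_measurable M) \<and>
     (AE \<omega> in M. X 0 \<omega> = 0) \<and>
     (\<forall>(t :: nat \<Rightarrow> real) n. 0 \<le> t 0 \<longrightarrow> mono t \<longrightarrow>
        prob_space.indep_vars M (\<lambda>_. borel) (\<lambda>i \<omega>. X (t (Suc i)) \<omega> - X (t i) \<omega>) {..<n}) \<and>
     (\<forall>s\<ge>0. \<forall>h\<ge>0. distr M borel (\<lambda>\<omega>. X (s + h) \<omega> - X s \<omega>) = distr M borel (X h)) \<and>
     (\<forall>\<omega>\<in>space M. cadlag (\<lambda>t. X t \<omega>))"

text \<open>
  The time \<open>\<zeta>\<close> is independent of the whole process \<open>X\<close> and exponentially distributed with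
  rate \<open>q\<close>.  For \<open>q = 0\<close> the condition on the tails says that \<open>\<zeta> = \<infinity>\<close> almost surely.
\<close>
definition killing_time :: "'a measure \<Rightarrow> (real \<Rightarrow> 'a \<Rightarrow> real) \<Rightarrow> real \<Rightarrow> ('a \<Rightarrow> ennreal) \<Rightarrow> bool" where
  "killing_time M X q \<zeta> \<longleftrightarrow>
     \<zeta> \<in> borel_measurable M \<and>
     (\<forall>t\<ge>0. measure M {\<omega> \<in> space M. ennreal t < \<zeta> \<omega>} = exp (- q * t)) \<and>
     prob_space.indep_set M
       (sets (vimage_algebra (space M) (\<lambda>\<omega>. \<lambda>t\<in>{0..}. X t \<omega>) (PiM {0..} (\<lambda>_. borel))))
       (sets (vimage_algebra (space M) \<zeta> borel))"

text \<open>The cemetery state is \<^term>\<open>None\<close>.\<close>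
definition killed_levy_process ::
  "'a measure \<Rightarrow> (real \<Rightarrow> 'a \<Rightarrow> real option) \<Rightarrow> ('a \<Rightarrow> ennreal) \<Rightarrow> bool" where
  "killed_levy_process M Y \<zeta> \<longleftrightarrow>
     (\<exists>X q. levy_process M X \<and> 0 \<le> q \<and> killing_time M X q \<zeta> \<and>
        (\<forall>\<omega>\<in>space M. \<forall>t\<ge>0. Y t \<omega> = (if ennreal t < \<zeta> \<omega> then Some (X t \<omega>) else None)))"

definition killed_exp :: "real \<Rightarrow> real option \<Rightarrow> real" where
  "killed_exp z y = (case y of None \<Rightarrow> 0 | Some x \<Rightarrow> exp (z * x))"

definition laplace_exponent_finite ::
  "'a measure \<Rightarrow> (real \<Rightarrow> 'a \<Rightarrow> real option) \<Rightarrow> real \<Rightarrow> bool" where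
  "laplace_exponent_finite M Y z \<longleftrightarrow> integrable M (\<lambda>\<omega>. killed_exp z (Y 1 \<omega>))"

text \<open>Meaningful only where \<^const>\<open>laplace_exponent_finite\<close> holds.\<close>
definition laplace_exponent ::
  "'a measure \<Rightarrow> (real \<Rightarrow> 'a \<Rightarrow> real option) \<Rightarrow> real \<Rightarrow> real" where
  "laplace_exponent M Y z = ln (\<integral>\<omega>. killed_exp z (Y 1 \<omega>) \<partial>M)"

text \<open>
  The expectation exists in the extended reals and is positive; the value \<open>+\<infinity>\<close> is allowed,
  which \<open>0 < integral\<^sup>L M Z\<close> would exclude.
\<close>
definition positive_expectation :: "'a measure \<Rightarrow> ('a \<Rightarrow> real) \<Rightarrow> bool" where
  "positive_expectation M Z \<longleftrightarrow>
     (\<integral>\<^sup>+\<omega>. ennreal (- Z \<omega>) \<partial>M) < (\<integral>\<^sup>+\<omega>. ennreal (Z \<omega>) \<partial>M)"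

definition exp_functional ::
  "(real \<Rightarrow> 'a \<Rightarrow> real option) \<Rightarrow> ('a \<Rightarrow> ennreal) \<Rightarrow> 'a \<Rightarrow> ennreal" where
  "exp_functional Y \<zeta> \<omega> =
     (\<integral>\<^sup>+t\<in>{t. 0 \<le> t \<and> ennreal t < \<zeta> \<omega>}. ennreal (exp (- the (Y t \<omega>))) \<partial>lborel)"

text \<open>
  The conversion to a real number is only relevant where the exponential functional is finite.
\<close>
definition mellin_exp_functional ::
  "'a measure \<Rightarrow> (real \<Rightarrow> 'a \<Rightarrow> real option) \<Rightarrow> ('a \<Rightarrow> ennreal) \<Rightarrow> complex \<Rightarrow> complex" where
  "mellin_exp_functional M Y \<zeta> s =
     (\<integral>\<omega>. complex_of_real (enn2real (exp_functional Y \<zeta> \<omega>)) powr (s - 1) \<partial>M)"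

definition strip :: "real \<Rightarrow> real \<Rightarrow> complex set" where
  "strip a b = {s. a < Re s \<and> Re s < b}"

text \<open>\<open>\<bar>Im s\<bar> \<rightarrow> \<infinity>\<close> inside a set \<open>S\<close>, uniformly in the real part.\<close>
definition at_Im_infinity_within :: "complex set \<Rightarrow> complex filter" where
  "at_Im_infinity_within S = inf (filtercomap (\<lambda>s. \<bar>Im s\<bar>) at_top) (principal S)"

end

theory Submission
  imports Defs "HOL-Complex_Analysis.Complex_Analysis" "HOL-Real_Asymp.Real_Asymp"
begin

text \<open>
  Write \<open>I\<close> for the exponential functional.  If \<open>\<psi>(-p) < 0\<close>, removing the drift
  \<open>-\<psi>(-p)/p\<close> from the process and applying a maximal inequality gives \<open>P(I > y) = O(y\<^sup>-\<^sup>p)\<close>,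
  so \<open>E[I\<^sup>r]\<close> is finite for \<open>0 < r < \<theta>\<close>.  Let \<open>I\<^sub>u\<close> be the integral over the times after \<open>u\<close>.
  Since \<open>u \<mapsto> I\<^sub>u\<close> pushes \<open>exp (-Y\<^sub>u) du\<close> forward to Lebesgue measure on \<open>[0, I]\<close>,
  \<open>I\<^sup>s = s \<integral> exp (-Y\<^sub>u) I\<^sub>u\<^sup>s\<^sup>-\<^sup>1 du\<close>, and the Markov property at time \<open>u\<close> turns this into
  \<open>E[I\<^sup>s] = - s / \<psi>(-s) E[I\<^sup>s\<^sup>-\<^sup>1]\<close>, which also yields the negative moments.
  Hence the Mellin transform divided by \<open>f\<close> has period \<open>1\<close>, first on the reals and then, by the
  identity theorem, on the strip.  As a function of \<open>w = exp (2\<pi>is)\<close> it is holomorphic on the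
  punctured plane, \<open>o(1/|w|)\<close> at \<open>0\<close> and \<open>o(|w|)\<close> at \<open>\<infinity>\<close>, hence constant.
\<close>

section \<open>Periodic functions on a strip\<close>

text \<open>Sign of \<psi>: \<psi>(0) = -q is at most 0 and \<psi>(-\<theta>) = 0, so convexity
  gives \<psi>(-p) < 0 for 0 < p < \<theta>, strictly unless q = 0 and the process vanishes at time
  1 almost surely; the hypothesis on the mean excludes that case. The drift c = -\<psi>(-p)/p is the
  one for which exp (-p (X_t - c t)), restricted to survival, has mean one at every time; the
  maximal inequality rests on this. Measurability: laws of paths live on an uncountable product, so
  the functional is defined through limits over countable grids, and the Markov property is proved
  as an identity of laws on that product. Room in the strip: its width 1 + \<theta> exceeds the
  period. A branch of the logarithm uses a substrip of width 1 away from the boundary, where the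
  Mellin transform is bounded, so the quotient grows no faster than 1/f; the spare width \<theta>
  serves to glue across the branch cut. Negative moments come from reading the recurrence backwards:
  a finite left side and a nonzero factor force the lower moment to be finite.\<close>

lemma open_strip: "open (strip a b)"
proof -
  have "strip a b = {s. Re s > a} \<inter> {s. Re s < b}" by (auto simp: strip_def)
  then show ?thesis by (simp add: open_halfspace_Re_gt open_halfspace_Re_lt open_Int)
qed

lemma convex_strip: "convex (strip a b)"
proof -
  have "strip a b = {s. Re s > a} \<inter> {s. Re s < b}" by (auto simp: strip_def)
  then show ?thesis by (simp add: convex_halfspace_Re_gt convex_halfspace_Re_lt convex_Int)
qed

text \<open>Liouville's theorem for polynomial growth leaves degree at most 2 without constant term;
  the little-o bound then removes the square. Applied to \<open>k w = w * g w\<close>, it makes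
  \<open>g\<close> constant away from 0.\<close>

lemma entire_eq_linear_of_growth:
  assumes k: "k holomorphic_on UNIV" and k0: "k 0 = 0"
    and small: "\<And>e. e > 0 \<Longrightarrow> \<exists>B. \<forall>w. B \<le> cmod w \<longrightarrow> cmod (k w) \<le> e * cmod w ^ 2"
  shows "\<exists>c. \<forall>w. k w = c * w"
proof -
  obtain B where B: "\<forall>w. B \<le> cmod w \<longrightarrow> cmod (k w) \<le> 1 * cmod w ^ 2"
    using small[of 1] by auto
  define a where "a = deriv k 0"
  define b where "b = (deriv ^^ 2) k 0 / 2"
  have eq: "k w = a * w + b * w ^ 2" for w
    using Liouville_polynomial[OF k, of B 1 2 w] B k0
    by (simp add: a_def b_def numeral_2_eq_2)
  have "b = 0"
  proof (rule ccontr)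
    assume "b \<noteq> 0"
    then have e: "cmod b / 4 > 0" by simp
    obtain B where B: "\<forall>w. B \<le> cmod w \<longrightarrow> cmod (k w) \<le> cmod b / 4 * cmod w ^ 2"
      using small[OF e] by auto
    \<comment> \<open>So large that the linear term is at most half the quadratic one. With the
      quarter from the growth bound this gives |b| r^2 <= (3/4) |b| r^2, impossible for nonzero
      \<open>b\<close>.\<close>
    define r where "r = max (max B 1) (2 * cmod a / cmod b)"
    have r: "r \<ge> B" "r \<ge> 1" "r \<ge> 2 * cmod a / cmod b" by (auto simp: r_def)
    have "cmod (k (of_real r)) \<le> cmod b / 4 * r ^ 2"
      using B r by (metis abs_of_nonneg norm_of_real order_trans zero_le_one)
    moreover have "cmod (b * of_real r ^ 2) \<le> cmod (k (of_real r)) + cmod (a * of_real r)"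
      unfolding eq[of "of_real r"] by (metis add_diff_cancel_left' norm_triangle_ineq4)
    moreover have "cmod a * r \<le> cmod b / 2 * r ^ 2"
    proof -
      have "cmod a \<le> cmod b / 2 * r" using r(3) \<open>b \<noteq> 0\<close> by (simp add: field_simps)
      then have "cmod a * r \<le> (cmod b / 2 * r) * r" using r by (intro mult_right_mono) auto
      then show ?thesis by (simp add: power2_eq_square)
    qed
    moreover have "cmod b * r ^ 2 > 0" using \<open>b \<noteq> 0\<close> r by (intro mult_pos_pos) auto
    moreover have "cmod (b * of_real r ^ 2) = cmod b * r ^ 2" "cmod (a * of_real r) = cmod a * r"
      using r by (auto simp: norm_mult norm_power)
    ultimately show False by linarith
  qed
  then show ?thesis using eq by (intro exI[of _ a]) simp
qed

text \<open>This inverts w = exp (2 pi i (s - b)), centred at the middle \<open>b\<close> of the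
  strip: the principal logarithm moves Re s by at most 1/2, so the point stays inside. On the
  negative axis, where \<open>Ln w\<close> jumps, the same function is written with
  \<open>Ln (- w)\<close>; periodicity makes the two expressions agree.\<close>

lemma periodic_strip_descends:
  assumes F: "F holomorphic_on strip 0 (1 + \<theta>)" and th: "0 < \<theta>"
    and per: "\<And>s. s \<in> strip 0 \<theta> \<Longrightarrow> F (s + 1) = F s"
  defines "b \<equiv> complex_of_real ((1 + \<theta>) / 2)"
  shows "(\<lambda>w. F (b + Ln w / (2 * of_real pi * \<i>))) holomorphic_on - {0}"
proof -
  define L where "L w = Ln w / (2 * of_real pi * \<i>)" for w
  have ReL: "Re (L w) = Im (Ln w) / (2 * pi)" for w
    by (simp add: L_def Re_divide power2_eq_square field_simps)
  define g where "g w = F (b + L w)" for w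
  have instrip: "b + L w \<in> strip 0 (1 + \<theta>)" if "w \<noteq> 0" for w
  proof -
    have "- pi < Im (Ln w)" "Im (Ln w) \<le> pi" using mpi_less_Im_Ln Im_Ln_le_pi that by auto
    then have "-1/2 < Re (L w)" "Re (L w) \<le> 1/2" unfolding ReL by (auto simp: field_simps)
    then show ?thesis using th by (auto simp: strip_def b_def field_simps)
  qed
  have Lhol: "L holomorphic_on - \<real>\<^sub>\<le>\<^sub>0"
    unfolding L_def by (intro holomorphic_intros) auto
  have g1: "g holomorphic_on - \<real>\<^sub>\<le>\<^sub>0"
  proof -
    have "(F \<circ> (\<lambda>w. b + L w)) holomorphic_on - \<real>\<^sub>\<le>\<^sub>0"
      by (rule holomorphic_on_compose_gen[OF _ F])
         (use Lhol instrip in \<open>auto intro!: holomorphic_intros instrip simp: image_subset_iff\<close>)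
    then show ?thesis by (simp add: o_def g_def[abs_def])
  qed
  \<comment> \<open>A neighbourhood of the negative axis on which \<open>b + 1/2 + L (- w)\<close>
    has real part in (1, 1 + \<theta>), because Re b + 1/2 = 1 + \<theta>/2.\<close>
  define S where "S = uminus -` (- \<real>\<^sub>\<le>\<^sub>0 \<inter> (\<lambda>w. Re (L w)) -` {- \<theta>/2 <..< \<theta>/2})"
  have opS: "open S"
  proof -
    have "continuous_on (- \<real>\<^sub>\<le>\<^sub>0) (\<lambda>w. Re (L w))"
      by (intro continuous_intros holomorphic_on_imp_continuous_on Lhol)
    then have "open (- \<real>\<^sub>\<le>\<^sub>0 \<inter> (\<lambda>w. Re (L w)) -` {- \<theta>/2 <..< \<theta>/2})"
      by (intro continuous_open_preimage) auto
    then show ?thesis unfolding S_def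
      by (intro open_vimage continuous_intros) auto
  qed
  define g' where "g' w = F (b + 1/2 + L (- w))" for w
  have g2: "g' holomorphic_on S"
  proof -
    have "(F \<circ> (\<lambda>w. b + 1/2 + L (- w))) holomorphic_on S"
    proof (rule holomorphic_on_compose_gen[OF _ F])
      have "(L \<circ> uminus) holomorphic_on S"
        by (rule holomorphic_on_compose_gen[OF _ Lhol]) (auto intro!: holomorphic_intros simp: S_def)
      then show "(\<lambda>w. b + 1/2 + L (- w)) holomorphic_on S"
        by (auto intro!: holomorphic_intros simp: o_def)
      show "(\<lambda>w. b + 1/2 + L (- w)) ` S \<subseteq> strip 0 (1 + \<theta>)"
        using th by (auto simp: S_def strip_def b_def field_simps)
    qed
    then show ?thesis by (simp add: o_def g'_def[abs_def])
  qed
  have gg': "g w = g' w" if "w \<in> S" for w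
  proof -
    have w0: "w \<noteq> 0" "- w \<noteq> 0" using that by (auto simp: S_def)
    \<comment> \<open>Passing to \<open>Ln (- w)\<close> adds or subtracts i pi, that is 1/2 after
      division by 2 pi i. With the minus sign \<open>g'\<close> is literally \<open>g\<close>; with
      the plus sign its argument is moved by one period.\<close>
    have Lm: "L (- w) = L w + (if Im w \<le> 0 \<and> \<not> (Re w < 0 \<and> Im w = 0) then 1/2 else - 1/2)"
      unfolding L_def Ln_minus[OF w0(1)] using w0 by (simp add: field_simps)
    show ?thesis
    proof (cases "Im w \<le> 0 \<and> \<not> (Re w < 0 \<and> Im w = 0)")
      case True
      then have eq: "L (- w) = L w + 1/2" using Lm by simp
      have "- \<theta> / 2 < Re (L (- w))" "Re (L (- w)) < \<theta> / 2" using that by (auto simp: S_def)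
      then have "b + L w \<in> strip 0 \<theta>"
        using eq by (auto simp: strip_def b_def field_simps)
      from per[OF this] show ?thesis by (simp add: g_def g'_def eq algebra_simps)
    next
      case False
      then have "L (- w) = L w - 1/2" using Lm by auto
      then show ?thesis by (simp add: g_def g'_def)
    qed
  qed
  have g3: "g holomorphic_on S" using g2 gg' holomorphic_cong by metis
  have cov: "- {0} = - \<real>\<^sub>\<le>\<^sub>0 \<union> S"
  proof -
    have "w \<in> S" if "w \<noteq> 0" "w \<in> \<real>\<^sub>\<le>\<^sub>0" for w
    proof -
      from that obtain x where x: "w = of_real x" "x < 0"
        by (auto elim!: nonpos_Reals_cases simp: less_le)
      have wx: "- w = of_real (- x)" using x by simp
      then have "- w \<notin> \<real>\<^sub>\<le>\<^sub>0" using x by (metis complex_nonpos_Reals_iff Re_complex_of_real neg_le_0_iff_le not_le)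
      moreover have "Im (Ln (- w)) = 0" unfolding wx using Ln_of_real[of "- x"] x by (metis Im_complex_of_real neg_0_less_iff_less)
      ultimately show ?thesis using th by (simp add: S_def ReL)
    qed
    moreover have "0 \<notin> S" by (auto simp: S_def)
    ultimately show ?thesis by auto
  qed
  have "g holomorphic_on (- \<real>\<^sub>\<le>\<^sub>0 \<union> S)"
    by (rule holomorphic_on_Un[OF g1 g3]) (auto simp: opS)
  then show ?thesis unfolding cov[symmetric] by (simp add: g_def[abs_def] L_def)
qed

text \<open>The branch \<open>b + L w\<close> has real part in (\<theta>/2, 1 + \<theta>/2], so
  growth is required only there. Since |Im s| = |ln |w|| / (2 pi), the factor exp (2 pi |Im s|) is
  1/|w| near 0 and |w| near infinity.\<close>

lemma periodic_strip_constant: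
  assumes F: "F holomorphic_on strip 0 (1 + \<theta>)" and th: "0 < \<theta>"
    and per: "\<And>s. s \<in> strip 0 \<theta> \<Longrightarrow> F (s + 1) = F s"
    and growth: "\<And>e. e > 0 \<Longrightarrow> \<exists>B. \<forall>s\<in>strip (\<theta>/2) (1 + \<theta>). Re s \<le> 1 + \<theta>/2 \<longrightarrow>
        B \<le> \<bar>Im s\<bar> \<longrightarrow> cmod (F s) \<le> e * exp (2 * pi * \<bar>Im s\<bar>)"
  shows "\<exists>c. \<forall>s\<in>strip 0 (1 + \<theta>). F s = c"
proof -
  define b where "b = complex_of_real ((1 + \<theta>) / 2)"
  define L where "L w = Ln w / (2 * of_real pi * \<i>)" for w
  have ReL: "Re (L w) = Im (Ln w) / (2 * pi)" for w
    by (simp add: L_def Re_divide power2_eq_square field_simps)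
  have ImL: "Im (L w) = - (ln (cmod w)) / (2 * pi)" if "w \<noteq> 0" for w
    using that by (simp add: L_def Im_divide power2_eq_square field_simps)
  define g where "g w = F (b + L w)" for w
  have ghol: "g holomorphic_on - {0}"
    using periodic_strip_descends[OF F th per] by (simp add: g_def[abs_def] b_def L_def)
  have small: "\<exists>B. \<forall>w. w \<noteq> 0 \<longrightarrow> B \<le> \<bar>ln (cmod w)\<bar> \<longrightarrow> cmod (g w) \<le> e * exp \<bar>ln (cmod w)\<bar>"
    if "e > 0" for e
  proof -
    obtain B where B: "\<forall>s\<in>strip (\<theta>/2) (1 + \<theta>). Re s \<le> 1 + \<theta>/2 \<longrightarrow>
        B \<le> \<bar>Im s\<bar> \<longrightarrow> cmod (F s) \<le> e * exp (2 * pi * \<bar>Im s\<bar>)" using growth[OF \<open>e > 0\<close>] by blast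
    show ?thesis
    proof (intro exI[of _ "2 * pi * B"] allI impI)
      fix w :: complex assume w: "w \<noteq> 0" "2 * pi * B \<le> \<bar>ln (cmod w)\<bar>"
      have "- pi < Im (Ln w)" "Im (Ln w) \<le> pi" using mpi_less_Im_Ln Im_Ln_le_pi w by auto
      then have "-1/2 < Re (L w)" "Re (L w) \<le> 1/2" unfolding ReL by (auto simp: field_simps)
      then have 1: "b + L w \<in> strip (\<theta>/2) (1 + \<theta>)" "Re (b + L w) \<le> 1 + \<theta>/2"
        using th by (auto simp: strip_def b_def field_simps)
      have 2: "2 * pi * \<bar>Im (b + L w)\<bar> = \<bar>ln (cmod w)\<bar>"
        by (simp add: ImL[OF w(1)] b_def abs_mult)
      have "B \<le> \<bar>Im (b + L w)\<bar>"
      proof -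
        have "2 * pi * B \<le> 2 * pi * \<bar>Im (b + L w)\<bar>" using 2 w by simp
        then show ?thesis by simp
      qed
      then show "cmod (g w) \<le> e * exp \<bar>ln (cmod w)\<bar>"
        using B 1 2 unfolding g_def by metis
    qed
  qed
  \<comment> \<open>The factor \<open>w\<close> turns o(1/|w|) at 0 into a removable singularity
    with value 0, and o(|w|) at infinity into o(|w|^2).\<close>
  define k where "k w = w * g w" for w
  have k0: "k 0 = 0" by (simp add: k_def)
  have k_lim: "(k \<longlongrightarrow> k 0) (at 0 within UNIV)"
  proof (rule tendstoI)
    fix e :: real assume "e > 0"
    then obtain B where B: "\<forall>w. w \<noteq> 0 \<longrightarrow> B \<le> \<bar>ln (cmod w)\<bar> \<longrightarrow> cmod (g w) \<le> e/2 * exp \<bar>ln (cmod w)\<bar>"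
      using small[of "e/2"] by auto
    define d where "d = min 1 (exp (- B))"
    have "d > 0" by (simp add: d_def)
    have "dist (k w) (k 0) < e" if "w \<noteq> 0" "dist w 0 < d" for w
    proof -
      have w: "0 < cmod w" "cmod w < 1" "cmod w < exp (-B)" using that by (auto simp: d_def)
      have ln: "ln (cmod w) < 0" using w by simp
      have "ln (cmod w) < - B" using w by (metis ln_less_cancel_iff exp_gt_zero ln_exp)
      then have "B \<le> \<bar>ln (cmod w)\<bar>" using ln by simp
      then have "cmod (g w) \<le> e/2 * exp \<bar>ln (cmod w)\<bar>" using B that by blast
      also have "exp \<bar>ln (cmod w)\<bar> = 1 / cmod w"
        using ln w by (simp add: exp_minus inverse_eq_divide)
      finally have "cmod (k w) \<le> e / 2" using w by (simp add: k_def norm_mult field_simps)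
      then show ?thesis using \<open>e > 0\<close> k0 by simp
    qed
    then show "\<forall>\<^sub>F w in at 0. dist (k w) (k 0) < e"
      using \<open>d > 0\<close> unfolding eventually_at by auto
  qed
  have khol: "k holomorphic_on UNIV"
  proof (rule no_isolated_singularity'[where K="{0}"])
    show "k holomorphic_on UNIV - {0}"
      using ghol unfolding k_def[abs_def] Compl_eq_Diff_UNIV by (intro holomorphic_intros)
  qed (use k_lim in auto)
  have "\<exists>c. \<forall>w. k w = c * w"
  proof (rule entire_eq_linear_of_growth[OF khol k0])
    fix e :: real assume "e > 0"
    then obtain B where B: "\<forall>w. w \<noteq> 0 \<longrightarrow> B \<le> \<bar>ln (cmod w)\<bar> \<longrightarrow> cmod (g w) \<le> e * exp \<bar>ln (cmod w)\<bar>"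
      using small by blast
    show "\<exists>B. \<forall>w. B \<le> cmod w \<longrightarrow> cmod (k w) \<le> e * cmod w ^ 2"
    proof (intro exI[of _ "max 1 (exp B)"] allI impI)
      fix w assume "max 1 (exp B) \<le> cmod w"
      then have w: "1 \<le> cmod w" "exp B \<le> cmod w" by auto
      have "B \<le> ln (cmod w)" using w ln_mono[of "exp B" "cmod w"] by auto
      moreover have "0 \<le> ln (cmod w)" using w by simp
      moreover have "w \<noteq> 0" using w by auto
      ultimately have "cmod (g w) \<le> e * exp \<bar>ln (cmod w)\<bar>" using B by (metis abs_of_nonneg)
      moreover have "exp \<bar>ln (cmod w)\<bar> = cmod w" using \<open>0 \<le> ln (cmod w)\<close> w by auto
      ultimately have "cmod w * cmod (g w) \<le> cmod w * (e * cmod w)"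
        by (intro mult_left_mono) auto
      then show "cmod (k w) \<le> e * cmod w ^ 2"
        by (simp add: k_def norm_mult power2_eq_square mult_ac)
    qed
  qed
  then obtain c where c: "\<And>w. k w = c * w" by blast
  have gc: "g w = c" if "w \<noteq> 0" for w using c[of w] that by (simp add: k_def)
  \<comment> \<open>Radius 1/2 keeps |Re (s - b)| < 1/2, the range in which \<open>Ln\<close>
    inverts the exponential. The identity theorem then reaches the whole strip.\<close>
  have Fc: "F s = c" if "s \<in> ball b (1/2)" for s
  proof -
    define w where "w = exp (2 * of_real pi * \<i> * (s - b))"
    have "cmod (s - b) < 1/2" using that by (simp add: dist_norm norm_minus_commute)
    then have "\<bar>Re (s - b)\<bar> < 1/2" using abs_Re_le_cmod[of "s - b"] by linarith
    then have bd: "- (1/2) < Re (s - b)" "Re (s - b) < 1/2" by linarith+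
    have im: "Im (2 * of_real pi * \<i> * (s - b)) = 2 * pi * Re (s - b)" by simp
    have "Ln w = 2 * of_real pi * \<i> * (s - b)"
      unfolding w_def
    proof (rule Ln_exp)
      show "- pi < Im (2 * of_real pi * \<i> * (s - b))"
        unfolding im using bd(1) mult_strict_left_mono[OF bd(1), of "2 * pi"] by simp
      show "Im (2 * of_real pi * \<i> * (s - b)) \<le> pi"
        unfolding im using bd(2) mult_strict_left_mono[OF bd(2), of "2 * pi"] by simp
    qed
    then have "L w = s - b" by (simp add: L_def)
    moreover have "w \<noteq> 0" by (simp add: w_def)
    ultimately show ?thesis using gc[of w] by (simp add: g_def)
  qed
  have "F s = c" if s: "s \<in> strip 0 (1 + \<theta>)" for s
  proof -
    have bs: "b \<in> strip 0 (1 + \<theta>)" using th by (auto simp: strip_def b_def)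
    show ?thesis
    proof (rule analytic_continuation_open[where s="ball b (1/2) \<inter> strip 0 (1+\<theta>)" and s'="strip 0 (1 + \<theta>)" and f=F and g="\<lambda>_. c"])
      show "ball b (1/2) \<inter> strip 0 (1+\<theta>) \<noteq> {}" using bs by force
    qed (use bs s F Fc in \<open>auto simp: open_strip convex_connected convex_strip intro!: open_Int\<close>)
  qed
  then show ?thesis by blast
qed

section \<open>Mellin transforms\<close>

text \<open>Supplies the majorant of difference quotients. One factor exp (\<epsilon> |l|) comes
  from Taylor's bound, the other from |l| <= exp (\<epsilon> |l|) / \<epsilon>; summing both signs
  removes the absolute value from the exponent.\<close>

lemma norm_exp_mult_real_diff_le:
  fixes s h :: complex and l \<epsilon> :: real
  assumes \<epsilon>: "\<epsilon> > 0" and h: "cmod h \<le> \<epsilon>"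
  shows "cmod (exp ((s + h) * of_real l) - exp (s * of_real l))
    \<le> cmod h * ((exp ((Re s + 2 * \<epsilon>) * l) + exp ((Re s - 2 * \<epsilon>) * l)) / \<epsilon>)"
proof -
  have "cmod (exp (h * of_real l) - 1) \<le> exp \<bar>Re (h * of_real l)\<bar> * cmod (h * of_real l)"
    using Taylor_exp[of "h * of_real l" 0] by simp
  also have "\<dots> \<le> exp (\<epsilon> * \<bar>l\<bar>) * (cmod h * \<bar>l\<bar>)"
  proof (intro mult_mono)
    have "\<bar>Re h\<bar> * \<bar>l\<bar> \<le> \<epsilon> * \<bar>l\<bar>"
      using abs_Re_le_cmod[of h] h by (intro mult_right_mono) auto
    then show "exp \<bar>Re (h * complex_of_real l)\<bar> \<le> exp (\<epsilon> * \<bar>l\<bar>)"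
      by (simp add: abs_mult)
  qed (auto simp: norm_mult)
  also have "\<bar>l\<bar> \<le> exp (\<epsilon> * \<bar>l\<bar>) / \<epsilon>"
  proof -
    have "\<epsilon> * \<bar>l\<bar> \<le> exp (\<epsilon> * \<bar>l\<bar>)"
      using exp_ge_add_one_self[of "\<epsilon> * \<bar>l\<bar>"] by linarith
    then show ?thesis using \<epsilon> by (simp add: field_simps)
  qed
  then have "exp (\<epsilon> * \<bar>l\<bar>) * (cmod h * \<bar>l\<bar>) \<le> exp (\<epsilon> * \<bar>l\<bar>) * (cmod h * (exp (\<epsilon> * \<bar>l\<bar>) / \<epsilon>))"
    by (intro mult_left_mono) auto
  also have "\<dots> = cmod h * (exp (2 * \<epsilon> * \<bar>l\<bar>) / \<epsilon>)"
    by (simp add: exp_add[symmetric] flip: exp_add)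
  also have "\<dots> \<le> cmod h * ((exp (2 * \<epsilon> * l) + exp (- (2 * \<epsilon> * l))) / \<epsilon>)"
    using \<epsilon> by (intro mult_left_mono divide_right_mono) (auto simp: abs_if)
  finally have 1: "cmod (exp (h * of_real l) - 1)
      \<le> cmod h * ((exp (2 * \<epsilon> * l) + exp (- (2 * \<epsilon> * l))) / \<epsilon>)" .
  have "exp ((s + h) * of_real l) - exp (s * of_real l) = exp (s * of_real l) * (exp (h * of_real l) - 1)"
    by (simp add: algebra_simps exp_add)
  then have "cmod (exp ((s + h) * of_real l) - exp (s * of_real l))
      = exp (Re s * l) * cmod (exp (h * of_real l) - 1)"
    by (simp add: norm_mult)
  also have "\<dots> \<le> exp (Re s * l) * (cmod h * ((exp (2 * \<epsilon> * l) + exp (- (2 * \<epsilon> * l))) / \<epsilon>))"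
    using 1 by (intro mult_left_mono) auto
  also have "\<dots> = cmod h * ((exp ((Re s + 2 * \<epsilon>) * l) + exp ((Re s - 2 * \<epsilon>) * l)) / \<epsilon>)"
    by (simp add: field_simps exp_add exp_diff exp_minus)
  finally show ?thesis .
qed

text \<open>Dominated convergence for the difference quotients along sequences; the majorant needs
  only exponential moments slightly to both sides of Re s.\<close>

lemma two_sided_laplace_holomorphic:
  fixes L :: "'a \<Rightarrow> real"
  assumes L [measurable]: "L \<in> borel_measurable M"
    and int: "\<And>p. a < p \<Longrightarrow> p < b \<Longrightarrow> integrable M (\<lambda>\<omega>. exp (p * L \<omega>))"
  shows "(\<lambda>s. \<integral>\<omega>. exp (s * of_real (L \<omega>)) \<partial>M) holomorphic_on strip a b"
proof -
  define \<Phi> where "\<Phi> s = (\<integral>\<omega>. exp (s * complex_of_real (L \<omega>)) \<partial>M)" for s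
  have intc: "integrable M (\<lambda>\<omega>. exp (s * complex_of_real (L \<omega>)))" if "s \<in> strip a b" for s
    using that int[of "Re s"]
    by (intro Bochner_Integration.integrable_bound[OF int[of "Re s"]]) (auto simp: strip_def)
  have "\<exists>D. (\<Phi> has_field_derivative D) (at s)" if s: "s \<in> strip a b" for s
  proof -
    \<comment> \<open>A quarter of the distance to the boundary, so that exponents displaced by 2
      \<epsilon> remain in (a, b).\<close>
    define \<epsilon> where "\<epsilon> = min (Re s - a) (b - Re s) / 4"
    have \<epsilon>: "\<epsilon> > 0" "a < Re s - 2 * \<epsilon>" "Re s + 2 * \<epsilon> < b"
      using s by (auto simp: strip_def \<epsilon>_def min_def field_simps)
    define D where "D = (\<integral>\<omega>. exp (s * of_real (L \<omega>)) * of_real (L \<omega>) \<partial>M)"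
    have "((\<lambda>y. (\<Phi> y - \<Phi> s) / (y - s)) \<longlongrightarrow> D) (at s within ball s \<epsilon>)"
      unfolding tendsto_at_iff_sequentially
    proof (intro allI impI)
      fix X assume X: "\<forall>i. X i \<in> ball s \<epsilon> - {s}" and lim: "X \<longlonglongrightarrow> s"
      have Xs: "X i \<in> strip a b" for i
      proof -
        have "\<bar>Re (X i - s)\<bar> < \<epsilon>"
          using X abs_Re_le_cmod[of "X i - s"] by (auto simp: dist_norm norm_minus_commute intro: le_less_trans)
        then show ?thesis using \<epsilon> by (auto simp: strip_def)
      qed
      have "(\<lambda>i. \<integral>\<omega>. (exp (X i * of_real (L \<omega>)) - exp (s * of_real (L \<omega>))) / (X i - s) \<partial>M) \<longlonglongrightarrow> D"
        unfolding D_def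
      proof (rule integral_dominated_convergence[where
            w="\<lambda>\<omega>. (exp ((Re s + 2 * \<epsilon>) * L \<omega>) + exp ((Re s - 2 * \<epsilon>) * L \<omega>)) / \<epsilon>"])
        show "integrable M (\<lambda>\<omega>. (exp ((Re s + 2 * \<epsilon>) * L \<omega>) + exp ((Re s - 2 * \<epsilon>) * L \<omega>)) / \<epsilon>)"
          using \<epsilon> by (intro integrable_divide_zero Bochner_Integration.integrable_add int) auto
        show "AE \<omega> in M. (\<lambda>i. (exp (X i * of_real (L \<omega>)) - exp (s * of_real (L \<omega>))) / (X i - s))
            \<longlonglongrightarrow> exp (s * of_real (L \<omega>)) * of_real (L \<omega>)"
        proof (intro AE_I2)
          fix \<omega>
          have "((\<lambda>z. exp (z * of_real (L \<omega>))) has_field_derivative exp (s * of_real (L \<omega>)) * of_real (L \<omega>)) (at s)"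
            by (auto intro!: derivative_eq_intros)
          then have "((\<lambda>y. (exp (y * of_real (L \<omega>)) - exp (s * of_real (L \<omega>))) / (y - s))
              \<longlongrightarrow> exp (s * of_real (L \<omega>)) * of_real (L \<omega>)) (at s)"
            by (simp add: has_field_derivative_iff)
          then show "(\<lambda>i. (exp (X i * of_real (L \<omega>)) - exp (s * of_real (L \<omega>))) / (X i - s))
            \<longlonglongrightarrow> exp (s * of_real (L \<omega>)) * of_real (L \<omega>)"
            unfolding tendsto_at_iff_sequentially using X lim by (auto simp: o_def)
        qed
        show "AE \<omega> in M. norm ((exp (X i * of_real (L \<omega>)) - exp (s * of_real (L \<omega>))) / (X i - s))
            \<le> (exp ((Re s + 2 * \<epsilon>) * L \<omega>) + exp ((Re s - 2 * \<epsilon>) * L \<omega>)) / \<epsilon>" for i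
        proof (intro AE_I2)
          fix \<omega>
          have pos: "0 < cmod (X i - s)" using X by auto
          have "cmod (X i - s) \<le> \<epsilon>" using X by (auto simp: dist_norm norm_minus_commute intro: less_imp_le)
          from norm_exp_mult_real_diff_le[OF \<epsilon>(1) this, of s "L \<omega>"] pos
          show "norm ((exp (X i * of_real (L \<omega>)) - exp (s * of_real (L \<omega>))) / (X i - s))
            \<le> (exp ((Re s + 2 * \<epsilon>) * L \<omega>) + exp ((Re s - 2 * \<epsilon>) * L \<omega>)) / \<epsilon>"
            by (simp add: norm_divide pos_divide_le_eq mult.commute)
        qed
      qed simp_all
      moreover have "(\<integral>\<omega>. (exp (X i * of_real (L \<omega>)) - exp (s * of_real (L \<omega>))) / (X i - s) \<partial>M)
          = (\<Phi> (X i) - \<Phi> s) / (X i - s)" for i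
        using intc[OF Xs[of i]] intc[OF s] by (simp add: \<Phi>_def)
      ultimately show "((\<lambda>y. (\<Phi> y - \<Phi> s) / (y - s)) \<circ> X) \<longlonglongrightarrow> D"
        by (simp only: o_def)
    qed
    moreover have "at s within ball s \<epsilon> = at s" using \<epsilon> by (intro at_within_open) auto
    ultimately have "(\<Phi> has_field_derivative D) (at s)" by (simp add: has_field_derivative_iff)
    then show ?thesis by blast
  qed
  then have "\<Phi> holomorphic_on strip a b"
    by (auto simp: holomorphic_on_def field_differentiable_def intro: has_field_derivative_at_within)
  then show ?thesis by (simp add: \<Phi>_def[abs_def])
qed

text \<open>The analytic half, with the process reduced to a positive random variable whose moments
  obey the recurrence. The quotient \<open>F\<close> is constant by periodicity and growth; its
  value at 1 is the total probability divided by \<open>f 1\<close>.\<close>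

lemma mellin_eq_of_functional_equation:
  fixes R :: "'a \<Rightarrow> real" and \<psi> :: "real \<Rightarrow> real"
  assumes M: "prob_space M" and R [measurable]: "R \<in> borel_measurable M" and Rpos: "AE \<omega> in M. 0 < R \<omega>"
    and th: "0 < \<theta>"
    and int: "\<And>p. 0 < p \<Longrightarrow> p < 1 + \<theta> \<Longrightarrow> integrable M (\<lambda>\<omega>. R \<omega> powr (p - 1))"
    and rec: "\<And>s. 0 < s \<Longrightarrow> s < \<theta> \<Longrightarrow> \<psi> s \<noteq> 0 \<and>
      (\<integral>\<omega>. R \<omega> powr s \<partial>M) = - s / \<psi> s * (\<integral>\<omega>. R \<omega> powr (s - 1) \<partial>M)"
    and f_hol: "f holomorphic_on strip 0 (1 + \<theta>)"
    and f_nonzero: "\<And>s. s \<in> strip 0 (1 + \<theta>) \<Longrightarrow> f s \<noteq> 0"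
    and f_one: "f 1 = 1"
    and f_eq: "\<And>s :: real. 0 < s \<Longrightarrow> s < \<theta> \<Longrightarrow>
      f (complex_of_real (s + 1)) =
        - complex_of_real s * f (complex_of_real s) / complex_of_real (\<psi> s)"
    and f_growth: "(\<lambda>s. inverse (cmod (f s)))
      \<in> o[at_Im_infinity_within (strip 0 (1 + \<theta>))](\<lambda>s. exp (2 * pi * \<bar>Im s\<bar>))"
    and s: "s \<in> strip 0 (1 + \<theta>)"
  shows "(\<integral>\<omega>. complex_of_real (R \<omega>) powr (s - 1) \<partial>M) = f s"
proof -
  interpret prob_space M by fact
  define L where "L \<omega> = ln (R \<omega>)" for \<omega>
  have [measurable]: "L \<in> borel_measurable M" by (simp add: L_def[abs_def])
  define m where "m s = (\<integral>\<omega>. exp ((s - 1) * complex_of_real (L \<omega>)) \<partial>M)" for s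
  define \<mu> where "\<mu> p = (\<integral>\<omega>. R \<omega> powr (p - 1) \<partial>M)" for p
  have Rexp: "AE \<omega> in M. R \<omega> powr p = exp (p * L \<omega>)" for p
    using Rpos by eventually_elim (auto simp: powr_def L_def)
  have intL: "integrable M (\<lambda>\<omega>. exp ((p - 1) * L \<omega>))" if "0 < p" "p < 1 + \<theta>" for p
    using int[OF that] Rexp[of "p - 1"] by (subst integrable_cong_AE[symmetric]) (auto simp: L_def)
  have \<mu>: "\<mu> p = (\<integral>\<omega>. exp ((p - 1) * L \<omega>) \<partial>M)" for p
    unfolding \<mu>_def using Rexp by (intro integral_cong_AE) auto
  have m_mellin: "(\<integral>\<omega>. complex_of_real (R \<omega>) powr (s - 1) \<partial>M) = m s" for s
    unfolding m_def
  proof (rule integral_cong_AE)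
    show "AE \<omega> in M. complex_of_real (R \<omega>) powr (s - 1) = exp ((s - 1) * complex_of_real (L \<omega>))"
      using Rpos by eventually_elim (auto simp: powr_def L_def Ln_of_real)
    show "(\<lambda>\<omega>. complex_of_real (R \<omega>) powr (s - 1)) \<in> borel_measurable M"
      unfolding powr_def by measurable
  qed simp
  have m_real: "m (of_real p) = of_real (\<mu> p)" for p
  proof -
    have "exp ((of_real p - 1) * complex_of_real l) = of_real (exp ((p - 1) * l))" for l
      using exp_of_real[of "(p - 1) * l", where 'a=complex] by simp
    then show ?thesis unfolding m_def \<mu> by (simp only: integral_complex_of_real)
  qed
  have m_hol: "m holomorphic_on strip 0 (1 + \<theta>)"
  proof -
    have "(\<lambda>s. \<integral>\<omega>. exp (s * of_real (L \<omega>)) \<partial>M) holomorphic_on strip (- 1) \<theta>"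
    proof (rule two_sided_laplace_holomorphic)
      show "integrable M (\<lambda>\<omega>. exp (p * L \<omega>))" if "- 1 < p" "p < \<theta>" for p
        using intL[of "p + 1"] that by simp
    qed simp
    then have "((\<lambda>s. \<integral>\<omega>. exp (s * of_real (L \<omega>)) \<partial>M) \<circ> (\<lambda>s. s - 1)) holomorphic_on strip 0 (1 + \<theta>)"
      by (intro holomorphic_on_compose_gen[where t="strip (-1) \<theta>"])
         (auto simp: strip_def intro!: holomorphic_intros)
    then show ?thesis by (simp add: o_def m_def[abs_def])
  qed
  \<comment> \<open>Whatever the sign of \<open>L \<omega>\<close>, one endpoint exponent dominates,
    so the transform is bounded on closed vertical substrips.\<close>
  have m_bound: "cmod (m s) \<le> \<mu> c + \<mu> d"
    if "0 < c" "c \<le> Re s" "Re s \<le> d" "d < 1 + \<theta>" for s c d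
  proof -
    have "cmod (m s) \<le> (\<integral>\<omega>. exp ((Re s - 1) * L \<omega>) \<partial>M)"
      unfolding m_def by (rule integral_norm_bound[THEN order_trans]) simp
    also have "\<dots> \<le> (\<integral>\<omega>. exp ((c - 1) * L \<omega>) + exp ((d - 1) * L \<omega>) \<partial>M)"
    proof (rule integral_mono)
      fix \<omega>
      have "(Re s - 1) * L \<omega> \<le> (c - 1) * L \<omega> \<or> (Re s - 1) * L \<omega> \<le> (d - 1) * L \<omega>"
        using that by (cases "L \<omega> \<ge> 0") (auto intro: mult_right_mono mult_right_mono_neg)
      then show "exp ((Re s - 1) * L \<omega>) \<le> exp ((c - 1) * L \<omega>) + exp ((d - 1) * L \<omega>)"
        by (metis add.commute add_increasing exp_ge_zero exp_le_cancel_iff)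
    qed (use that in \<open>auto intro!: intL Bochner_Integration.integrable_add\<close>)
    also have "\<dots> = \<mu> c + \<mu> d"
      unfolding \<mu> using that by (intro Bochner_Integration.integral_add intL) auto
    finally show ?thesis .
  qed
  define F where "F s = m s / f s" for s
  have F_hol: "F holomorphic_on strip 0 (1 + \<theta>)"
    unfolding F_def[abs_def] by (intro holomorphic_intros m_hol f_hol) (use f_nonzero in auto)
  have F_per_real: "F (of_real r + 1) = F (of_real r)" if "0 < r" "r < \<theta>" for r
  proof -
    have "\<mu> (r + 1) = - r / \<psi> r * \<mu> r" "\<psi> r \<noteq> 0" using rec[OF that] by (auto simp: \<mu>_def)
    moreover have "f (of_real r) \<noteq> 0" using that by (intro f_nonzero) (auto simp: strip_def)
    ultimately show ?thesis
      using m_real[of "r + 1"] m_real[of r] f_eq[OF that] that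
      by (simp add: F_def)
  qed
  have F_per: "F (s + 1) = F s" if s: "s \<in> strip 0 \<theta>" for s
  proof -
    \<comment> \<open>An interior point of the strip at which the reals of (0, \<theta>) accumulate,
      as the identity theorem requires.\<close>
    define \<xi> where "\<xi> = complex_of_real (\<theta> / 2)"
    have lim: "\<xi> islimpt of_real ` {0<..<\<theta>}"
      unfolding islimpt_sequential
    proof (intro exI conjI allI)
      define x where "x n = complex_of_real (\<theta> / 2 + \<theta> / 2 / (real n + 2))" for n
      show "x n \<in> of_real ` {0<..<\<theta>} - {\<xi>}" for n
      proof -
        have "\<theta> / 2 + \<theta> / 2 / (real n + 2) \<in> {0<..<\<theta>}" "\<theta> / 2 + \<theta> / 2 / (real n + 2) \<noteq> \<theta> / 2"
          using th by (auto simp: field_simps intro!: add_pos_nonneg)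
        then show ?thesis unfolding x_def \<xi>_def
          by (metis Diff_iff imageI of_real_eq_iff singletonD)
      qed
      have "(\<lambda>n. \<theta> / 2 + \<theta> / 2 / (real n + 2)) \<longlonglongrightarrow> \<theta> / 2" by real_asymp
      then show "x \<longlonglongrightarrow> \<xi>" unfolding x_def[abs_def] \<xi>_def by (intro tendsto_of_real)
    qed
    have "(F \<circ> (\<lambda>s. s + 1)) holomorphic_on strip 0 \<theta>"
      by (rule holomorphic_on_compose_gen[OF _ F_hol]) (auto intro!: holomorphic_intros simp: strip_def)
    then have hol: "(\<lambda>s. F (s + 1) - F s) holomorphic_on strip 0 \<theta>"
      using F_hol by (auto intro!: holomorphic_intros holomorphic_on_subset[OF F_hol] simp: o_def strip_def)
    have "F (s + 1) - F s = 0"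
      by (rule analytic_continuation[OF hol open_strip _ _ _ lim _ s])
         (use th F_per_real in \<open>auto simp: \<xi>_def strip_def convex_connected convex_strip[unfolded strip_def]\<close>)
    then show ?thesis by simp
  qed
  have growth: "\<exists>B. \<forall>s\<in>strip (\<theta>/2) (1 + \<theta>). Re s \<le> 1 + \<theta>/2 \<longrightarrow>
        B \<le> \<bar>Im s\<bar> \<longrightarrow> cmod (F s) \<le> e * exp (2 * pi * \<bar>Im s\<bar>)" if e: "e > 0" for e
  proof -
    define K where "K = \<mu> (\<theta>/2) + \<mu> (1 + \<theta>/2)"
    have K: "K \<ge> 0" unfolding K_def \<mu>_def by (intro add_nonneg_nonneg integral_nonneg_AE) auto
    \<comment> \<open>\<open>K + 1\<close> avoids a division by zero and still gives
      \<open>K * c \<le> e\<close>.\<close>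
    define c where "c = e / (K + 1)"
    have c: "c > 0" "K * c \<le> e" using K e by (auto simp: c_def field_simps)
    have "eventually (\<lambda>s. norm (inverse (cmod (f s))) \<le> c * norm (exp (2 * pi * \<bar>Im s\<bar>)))
        (at_Im_infinity_within (strip 0 (1 + \<theta>)))"
      using f_growth c(1) by (rule landau_o.smallD)
    then obtain B where B: "\<And>s. s \<in> strip 0 (1 + \<theta>) \<Longrightarrow> B \<le> \<bar>Im s\<bar> \<Longrightarrow>
        inverse (cmod (f s)) \<le> c * exp (2 * pi * \<bar>Im s\<bar>)"
      unfolding at_Im_infinity_within_def eventually_inf_principal eventually_filtercomap
        eventually_at_top_linorder by auto
    show ?thesis
    proof (intro exI[of _ B] ballI impI)
      fix s assume s: "s \<in> strip (\<theta>/2) (1 + \<theta>)" "Re s \<le> 1 + \<theta>/2" "B \<le> \<bar>Im s\<bar>"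
      then have s0: "s \<in> strip 0 (1 + \<theta>)" using th by (auto simp: strip_def)
      have "cmod (F s) = cmod (m s) * inverse (cmod (f s))"
        by (simp add: F_def norm_divide divide_inverse norm_mult norm_inverse)
      also have "\<dots> \<le> K * (c * exp (2 * pi * \<bar>Im s\<bar>))"
        unfolding K_def
        by (intro mult_mono m_bound B s0 s(3)) (use s th K in \<open>auto simp: strip_def K_def\<close>)
      also have "\<dots> = (K * c) * exp (2 * pi * \<bar>Im s\<bar>)" by simp
      also have "\<dots> \<le> e * exp (2 * pi * \<bar>Im s\<bar>)"
        by (intro mult_right_mono c) simp
      finally show "cmod (F s) \<le> e * exp (2 * pi * \<bar>Im s\<bar>)" .
    qed
  qed
  obtain c where c: "\<And>s. s \<in> strip 0 (1 + \<theta>) \<Longrightarrow> F s = c"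
    using periodic_strip_constant[OF F_hol th F_per growth] by blast
  have "m 1 = 1" using m_def[of 1] by (simp add: prob_space)
  moreover have "1 \<in> strip 0 (1 + \<theta>)" using th by (simp add: strip_def)
  ultimately have "c = 1" using c[of 1] f_one by (simp add: F_def)
  then have "m s = f s" using c[OF s] f_nonzero[OF s] by (simp add: F_def)
  then show ?thesis using m_mellin by simp
qed

section \<open>The probability integral transform\<close>

text \<open>Without atoms the cdf is continuous, so a proper non-empty sublevel set is a half-line
  {..x0}; right continuity at x0 shows that the level c is attained there. The two extreme sublevel
  sets force c to be the total mass or 0, by the limits of the cdf.\<close>

lemma (in finite_borel_measure) measure_cdf_le:
  assumes atoms: "\<And>x. measure M {x} = 0" and c: "0 \<le> c" "c \<le> measure M (space M)"
  shows "measure M {x. cdf M x \<le> c} = c"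
proof -
  have cont: "continuous_on UNIV (cdf M)"
    using isCont_cdf atoms by (simp add: continuous_at_imp_continuous_on)
  define A where "A = {x. cdf M x \<le> c}"
  have closed: "closed A"
    unfolding A_def using cont by (intro closed_Collect_le) auto
  consider "A = UNIV" | "A = {}" | "A \<noteq> UNIV" "A \<noteq> {}" by blast
  then have "measure M A = c"
  proof cases
    case 1
    have "cdf M x \<le> c" for x using 1 by (auto simp: A_def)
    then have "measure M (space M) \<le> c"
      by (intro tendsto_upperbound[OF cdf_lim_at_top]) auto
    then show ?thesis using c 1 by (simp add: borel_UNIV)
  next
    case 2
    have "c \<le> cdf M x" for x using 2 by (auto simp: A_def not_le intro: less_imp_le)
    then have "c \<le> 0"
      by (intro tendsto_lowerbound[OF cdf_lim_at_bot]) auto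
    then show ?thesis using c 2 by simp
  next
    case 3
    then obtain y where "y \<notin> A" by blast
    then have y: "c < cdf M y" by (simp add: A_def)
    have bdd: "bdd_above A"
    proof (rule bdd_aboveI[of _ y])
      fix x assume "x \<in> A"
      then have "cdf M x < cdf M y" using y by (simp add: A_def)
      then show "x \<le> y" by (metis cdf_nondecreasing linorder_not_le nle_le)
    qed
    define x0 where "x0 = Sup A"
    have x0: "x0 \<in> A" unfolding x0_def by (rule closed_contains_Sup) (use 3 bdd closed in auto)
    have "A = {..x0}"
    proof (intro equalityI subsetI)
      fix x assume "x \<in> {..x0}"
      then show "x \<in> A" using x0 cdf_nondecreasing[of x x0] by (auto simp: A_def)
    qed (auto simp: x0_def intro: cSup_upper bdd)
    then have "measure M A = cdf M x0" by (simp add: cdf_def)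
    moreover have "c \<le> cdf M x0"
    proof -
      have "c \<le> cdf M x" if "x0 < x" for x
      proof -
        have "x \<notin> A" using \<open>A = {..x0}\<close> that by simp
        then show ?thesis by (simp add: A_def)
      qed
      then have "eventually (\<lambda>x. c \<le> cdf M x) (at_right x0)"
        unfolding eventually_at_filter by (intro always_eventually) simp
      moreover have "(cdf M \<longlongrightarrow> cdf M x0) (at_right x0)"
        using cdf_is_right_cont by (simp add: continuous_within)
      ultimately show ?thesis by (intro tendsto_lowerbound) auto
    qed
    ultimately show ?thesis using x0 by (auto simp: A_def)
  qed
  then show ?thesis by (simp add: A_def)
qed

text \<open>Both sides are identified by their cdfs. The total mass is kept general because it will
  be the value of the exponential functional, not 1.\<close>

lemma (in finite_borel_measure) probability_integral_transform:
  assumes atoms: "\<And>x. measure M {x} = 0"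
  shows "distr M borel (cdf M) = density lborel (indicator {0..measure M (space M)})"
    (is "?P = ?Q")
proof (rule cdf_unique')
  let ?T = "measure M (space M)"
  have meas: "cdf M \<in> borel_measurable M"
    using borel_measurable_mono[of "cdf M"] cdf_nondecreasing M_is_borel
    by (simp add: mono_def measurable_cong_sets[OF M_is_borel refl])
  show P: "finite_borel_measure ?P"
    using meas by (intro finite_borel_measure.intro finite_measure_distr finite_borel_measure_axioms.intro) auto
  have fin: "emeasure ?Q (space ?Q) < \<infinity>" by (simp add: emeasure_density)
  then show Q: "finite_borel_measure ?Q"
    by (intro finite_borel_measure.intro finite_borel_measure_axioms.intro finite_measureI) auto
  show "cdf ?P = cdf ?Q"
  proof
    fix c :: real
    have P: "cdf ?P c = measure M {x. cdf M x \<le> c}"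
      using meas by (simp add: cdf_def measure_distr vimage_def borel_UNIV)
    have Q: "cdf ?Q c = measure lborel ({0..?T} \<inter> {..c})"
      by (simp add: cdf_def measure_def emeasure_density indicator_inter_arith[symmetric])
    consider "c < 0" | "0 \<le> c" "c \<le> ?T" | "?T < c" by linarith
    then show "cdf ?P c = cdf ?Q c"
    proof cases
      case 1
      then have "{x. cdf M x \<le> c} = {}" "{0..?T} \<inter> {..c} = {}" using cdf_nonneg by (auto simp: not_le intro: less_le_trans)
      then show ?thesis unfolding P Q by simp
    next
      case 2
      then have "{0..?T} \<inter> {..c} = {0..c}" by auto
      then show ?thesis unfolding P Q measure_cdf_le[OF atoms 2] using 2 by simp
    next
      case 3
      then have "{x. cdf M x \<le> c} = space M" "{0..?T} \<inter> {..c} = {0..?T}"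
        using cdf_bounded by (auto simp: borel_UNIV intro: order_trans less_imp_le)
      then show ?thesis unfolding P Q by simp
    qed
  qed
qed

lemma nn_integral_powr_from_0:
  fixes s c :: real
  assumes "0 < s" "0 \<le> c"
  shows "(\<integral>\<^sup>+v. indicator {0..c} v * ennreal (v powr (s - 1)) \<partial>lborel) = ennreal (c powr s / s)"
proof -
  have "((\<lambda>v. v powr (s - 1)) has_integral (c powr s / s)) {0..c}"
    using has_integral_powr_from_0[of "s - 1" c] assms by simp
  from nn_integral_has_integral_lebesgue'[OF _ this] show ?thesis
    by (simp add: mult.commute)
qed

text \<open>Formally this integrates the derivative of the s-th power of the tail, but
  \<open>a\<close> is merely measurable and s - 1 may be negative. Instead the tail is read as a
  cdf, whose image measure under the density \<open>a\<close> is Lebesgue measure on [0, I]; what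
  remains is the integral of v^(s-1).\<close>

lemma nn_integral_tail_powr:
  fixes a :: "real \<Rightarrow> ennreal"
  assumes a [measurable]: "a \<in> borel_measurable borel" and s: "0 < s"
    and I: "(\<integral>\<^sup>+u. a u \<partial>lborel) = ennreal I" "0 \<le> I"
  shows "(\<integral>\<^sup>+u. a u * ennreal (enn2real (\<integral>\<^sup>+t. a t * indicator {u..} t \<partial>lborel) powr (s - 1)) \<partial>lborel)
    = ennreal (I powr s / s)"
proof -
  \<comment> \<open>Reflection turns the tails {u..} into the half-lines {..-u} that a cdf
    measures.\<close>
  define N where "N = distr (density lborel a) borel uminus"
  have emN: "emeasure N A = (\<integral>\<^sup>+t. a t * indicator A (- t) \<partial>lborel)" if A: "A \<in> sets borel" for A
  proof -
    have "uminus -` A \<in> sets borel" using measurable_sets_borel[of uminus borel A] A by simp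
    then have "emeasure N A = (\<integral>\<^sup>+t. a t * indicator (uminus -` A) t \<partial>lborel)"
      unfolding N_def using A by (simp add: emeasure_distr emeasure_density)
    then show ?thesis by (simp add: indicator_def)
  qed
  have spN: "emeasure N (space N) = ennreal I"
    using emN[of UNIV] I by (simp add: N_def)
  interpret N: finite_borel_measure N
    by (intro finite_borel_measure.intro finite_borel_measure_axioms.intro finite_measureI)
       (simp_all add: spN, simp_all add: N_def)
  have tot: "measure N (space N) = I" using spN I by (simp add: measure_def)
  have atoms: "measure N {x} = 0" for x
  proof -
    have "AE t in lborel. t \<noteq> - x" by (rule AE_lborel_singleton)
    then have "emeasure N {x} = 0"
      using emN[of "{x}"] by (simp add: nn_integral_0_iff_AE) (auto elim!: eventually_mono simp: indicator_def)
    then show ?thesis by (simp add: measure_def)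
  qed
  have cdfN: "cdf N (- u) = enn2real (\<integral>\<^sup>+t. a t * indicator {u..} t \<partial>lborel)" for u
    unfolding cdf_def measure_def emN[of "{..- u}", simplified]
    by (intro arg_cong[where f=enn2real] nn_integral_cong) (auto simp: indicator_def)
  have cdf_meas [measurable]: "cdf N \<in> borel_measurable borel"
    using N.cdf_nondecreasing by (intro borel_measurable_mono) (simp add: mono_def)
  have "(\<integral>\<^sup>+u. a u * ennreal (enn2real (\<integral>\<^sup>+t. a t * indicator {u..} t \<partial>lborel) powr (s - 1)) \<partial>lborel)
      = (\<integral>\<^sup>+u. a u * ennreal (cdf N (- u) powr (s - 1)) \<partial>lborel)"
    by (simp add: cdfN)
  also have "\<dots> = (\<integral>\<^sup>+x. ennreal (cdf N x powr (s - 1)) \<partial>N)"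
    unfolding N_def[symmetric] by (subst (2) N_def) (simp add: nn_integral_distr nn_integral_density)
  also have "\<dots> = (\<integral>\<^sup>+v. ennreal (v powr (s - 1)) \<partial>distr N borel (cdf N))"
    using N.M_is_borel by (subst nn_integral_distr) (auto simp: measurable_cong_sets[OF N.M_is_borel refl])
  also have "\<dots> = ennreal (I powr s / s)"
    unfolding N.probability_integral_transform[OF atoms] tot using s I(2)
    by (simp add: nn_integral_density nn_integral_powr_from_0)
  finally show ?thesis .
qed

section \<open>The Markov property\<close>

text \<open>Open upper half-lines are stable under intersection and generate the Borel sets, but
  none contains 0; the total mass is therefore compared separately, through
  \<open>UNIV\<close>.\<close>

lemma distr_ennreal_eqI:
  fixes N N' :: "ennreal measure"
  assumes sets [simp]: "sets N = sets borel" "sets N' = sets borel"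
    and fin: "finite_measure N"
    and top: "emeasure N UNIV = emeasure N' UNIV"
    and tails: "\<And>t. emeasure N {t<..} = emeasure N' {t<..}"
  shows "N = N'"
proof (rule measure_eqI_generator_eq[where \<Omega>=UNIV and E="insert UNIV (range greaterThan)" and A="\<lambda>_. UNIV"])
  have "sets (borel :: ennreal measure) = sigma_sets UNIV (range greaterThan)"
    by (simp add: borel_Ioi)
  also have "\<dots> = sigma_sets UNIV (insert UNIV (range greaterThan))"
    by (rule sigma_sets_eqI) (auto intro: sigma_sets_top)
  finally show "sets N = sigma_sets UNIV (insert UNIV (range greaterThan))"
    "sets N' = sigma_sets UNIV (insert UNIV (range greaterThan))" by simp_all
  show "emeasure N UNIV \<noteq> \<infinity>" for i :: nat
    using finite_measure.emeasure_finite[OF fin] by simp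
  show "Int_stable (insert UNIV (range (greaterThan :: ennreal \<Rightarrow> _)))"
  proof -
    have "{a<..} \<inter> {b<..} = {max a b<..}" for a b :: ennreal by auto
    then show ?thesis by (auto simp: Int_stable_def)
  qed
qed (use top tails in auto)

text \<open>Fixes the unkilled process and the rate that \<open>killed_levy_process\<close> only
  asserts to exist, so that path and lifetime can be treated as independent data.\<close>

locale killed_levy = prob_space M for M :: "'a measure" +
  fixes X :: "real \<Rightarrow> 'a \<Rightarrow> real" and q :: real and \<zeta> :: "'a \<Rightarrow> ennreal"
  assumes levy: "levy_process M X" and q: "0 \<le> q" and killing: "killing_time M X q \<zeta>"
begin

abbreviation "paths \<equiv> PiM {0::real..} (\<lambda>_. borel :: real measure)"

definition path :: "'a \<Rightarrow> real \<Rightarrow> real" where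
  "path \<omega> = (\<lambda>t\<in>{0..}. X t \<omega>)"

definition shifted :: "real \<Rightarrow> 'a \<Rightarrow> real \<Rightarrow> real" where
  "shifted u \<omega> = (\<lambda>t\<in>{0..}. X (u + t) \<omega> - X u \<omega>)"

lemma X_measurable [measurable]: "0 \<le> t \<Longrightarrow> X t \<in> borel_measurable M"
  using levy by (simp add: levy_process_def)

lemma X_zero: "AE \<omega> in M. X 0 \<omega> = 0"
  using levy by (simp add: levy_process_def)

lemma X_cadlag: "\<omega> \<in> space M \<Longrightarrow> cadlag (\<lambda>t. X t \<omega>)"
  using levy by (simp add: levy_process_def)

lemma X_indep: "0 \<le> t 0 \<Longrightarrow> mono t \<Longrightarrow>
    indep_vars (\<lambda>_. borel) (\<lambda>i \<omega>. X (t (Suc i)) \<omega> - X (t i) \<omega>) {..<n}" for t :: "nat \<Rightarrow> real"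
  using levy by (simp add: levy_process_def)

lemma X_stationary: "0 \<le> s \<Longrightarrow> 0 \<le> h \<Longrightarrow>
    distr M borel (\<lambda>\<omega>. X (s + h) \<omega> - X s \<omega>) = distr M borel (X h)"
  using levy by (simp add: levy_process_def)

lemma \<zeta>_measurable [measurable]: "\<zeta> \<in> borel_measurable M"
  using killing by (simp add: killing_time_def)

lemma \<zeta>_tail: "0 \<le> t \<Longrightarrow> emeasure M {\<omega> \<in> space M. ennreal t < \<zeta> \<omega>} = ennreal (exp (- q * t))"
  using killing by (simp add: killing_time_def emeasure_eq_measure)

lemma path_measurable [measurable]: "path \<in> measurable M paths"
  unfolding path_def[abs_def] by (rule measurable_restrict) auto

lemma shifted_measurable [measurable]: "0 \<le> u \<Longrightarrow> shifted u \<in> measurable M paths"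
  unfolding shifted_def[abs_def] by (rule measurable_restrict) auto

text \<open>Turns independence of generated sigma-algebras into a product law, the form to which
  Fubini applies; agreement on rectangles suffices.\<close>

lemma path_\<zeta>_law:
  "distr M (paths \<Otimes>\<^sub>M borel) (\<lambda>\<omega>. (path \<omega>, \<zeta> \<omega>)) = distr M paths path \<Otimes>\<^sub>M distr M borel \<zeta>"
proof (rule pair_measure_eqI[symmetric])
  interpret P: prob_space "distr M paths path" by (rule prob_space_distr) simp
  interpret Z: prob_space "distr M borel \<zeta>" by (rule prob_space_distr) simp
  show "sigma_finite_measure (distr M paths path)" "sigma_finite_measure (distr M borel \<zeta>)"
    by unfold_locales
  fix A B assume AB: "A \<in> sets (distr M paths path)" "B \<in> sets (distr M borel \<zeta>)"
  then have [measurable]: "A \<in> sets paths" "B \<in> sets borel" by auto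
  have "path -` A \<inter> space M \<in> sets (vimage_algebra (space M) path paths)"
    "\<zeta> -` B \<inter> space M \<in> sets (vimage_algebra (space M) \<zeta> borel)"
    using AB by (auto intro!: in_vimage_algebra)
  then have "prob ((path -` A \<inter> space M) \<inter> (\<zeta> -` B \<inter> space M)) = prob (path -` A \<inter> space M) * prob (\<zeta> -` B \<inter> space M)"
    using killing unfolding killing_time_def path_def[abs_def, symmetric]
    by (auto dest: indep_setD)
  moreover have "(\<lambda>\<omega>. (path \<omega>, \<zeta> \<omega>)) -` (A \<times> B) \<inter> space M = (path -` A \<inter> space M) \<inter> (\<zeta> -` B \<inter> space M)"
    by auto
  ultimately show "emeasure (distr M paths path) A * emeasure (distr M borel \<zeta>) B =
      emeasure (distr M (paths \<Otimes>\<^sub>M borel) (\<lambda>\<omega>. (path \<omega>, \<zeta> \<omega>))) (A \<times> B)"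
    by (simp add: emeasure_distr emeasure_eq_measure ennreal_mult)
qed simp

text \<open>\<open>levy_process\<close> speaks only of consecutive increments along a monotone
  sequence of times. Displacements after time u are partial sums of such increments, whose joint law
  does not depend on the starting time, and X u is almost surely the increment preceding
  them.\<close>

lemma finite_dimensional_shift:
  assumes J: "finite J" "J \<subseteq> {0..}" and u: "0 \<le> u"
    and A: "\<And>t. t \<in> J \<Longrightarrow> A t \<in> sets borel" and B: "B \<in> sets borel"
  shows "emeasure M {\<omega>\<in>space M. X u \<omega> \<in> B \<and> (\<forall>t\<in>J. X (u + t) \<omega> - X u \<omega> \<in> A t)} =
    emeasure M {\<omega>\<in>space M. X u \<omega> \<in> B} * emeasure M {\<omega>\<in>space M. \<forall>t\<in>J. X t \<omega> \<in> A t}"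
proof (cases "J = {}")
  case True
  then show ?thesis by (simp add: emeasure_space_1)
next
  case False
  define l where "l = sorted_list_of_set J"
  define k where "k = length l"
  have l: "set l = J" "sorted l" using J by (auto simp: l_def)
  have k: "0 < k" using False l by (auto simp: k_def)
  \<comment> \<open>0 followed by the times of \<open>J\<close> in order, hence the index shift.
    \<open>min i k\<close> makes the sequence constant from k on, so that it is monotone on all
    naturals.\<close>
  define \<rho> where "\<rho> i = (if i = 0 then 0 else l ! (min i k - 1))" for i
  have \<rho>_nonneg: "0 \<le> \<rho> i" for i
  proof (cases "i = 0")
    case False
    have "l ! (min i k - 1) \<in> J" unfolding l(1)[symmetric] 
      by (rule nth_mem) (use k min.cobounded2[of i k] in \<open>unfold k_def[symmetric], linarith\<close>)
    then show ?thesis using False J by (auto simp: \<rho>_def)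
  qed (simp add: \<rho>_def)
  have \<rho>_mono: "mono \<rho>"
  proof (rule monoI)
    fix i j :: nat assume "i \<le> j"
    show "\<rho> i \<le> \<rho> j"
    proof (cases "i = 0")
      case True
      then show ?thesis using \<rho>_nonneg[of j] by (simp add: \<rho>_def)
    next
      case False
      have "min i k - 1 \<le> min j k - 1" "min j k - 1 < length l" using \<open>i \<le> j\<close> k by (auto simp: k_def[symmetric])
      then show ?thesis using False \<open>i \<le> j\<close> l sorted_nth_mono by (auto simp: \<rho>_def)
    qed
  qed
  \<comment> \<open>Time 0 is put in front of the grid translated by \<open>v\<close>: increment 0
    is X v - X 0, and increments 1 to k run along the grid.\<close>
  define \<tau> where "\<tau> v i = (if i = 0 then 0 else v + \<rho> (i - 1))" for v i
  define D where "D v i \<omega> = X (\<tau> v (Suc i)) \<omega> - X (\<tau> v i) \<omega>" for v i \<omega>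
  have D0: "D v 0 \<omega> = X v \<omega> - X 0 \<omega>" for v \<omega> by (simp add: D_def \<tau>_def \<rho>_def)
  have D1: "D v i \<omega> = X (v + \<rho> i) \<omega> - X (v + \<rho> (i - 1)) \<omega>" if "i \<noteq> 0" for v i \<omega>
    using that by (simp add: D_def \<tau>_def)
  have \<tau>_nonneg: "0 \<le> \<tau> v i" if "0 \<le> v" for v i using that \<rho>_nonneg by (simp add: \<tau>_def)
  have D_meas [measurable]: "D v i \<in> borel_measurable M" if "0 \<le> v" for v i
    unfolding D_def[abs_def] using \<tau>_nonneg[OF that] by measurable
  have indep: "indep_vars (\<lambda>_. borel) (D v) {..<Suc k}" if "0 \<le> v" for v
    unfolding D_def[abs_def]
  proof (rule X_indep)
    show "mono (\<tau> v)"
      using \<rho>_nonneg that monoD[OF \<rho>_mono] by (intro monoI) (auto simp: \<tau>_def)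
  qed (simp add: \<tau>_def)
  let ?K = "{1..k}"
  let ?P = "PiM ?K (\<lambda>_. borel :: real measure)"
  have law: "distr M ?P (\<lambda>\<omega>. \<lambda>i\<in>?K. D v i \<omega>) = PiM ?K (\<lambda>i. distr M borel (X (\<rho> i - \<rho> (i - 1))))"
    if v: "0 \<le> v" for v
  proof -
    have "indep_vars (\<lambda>_. borel) (D v) ?K"
      by (rule indep_vars_subset[OF indep[OF v]]) auto
    then have "distr M ?P (\<lambda>\<omega>. \<lambda>i\<in>?K. D v i \<omega>) = PiM ?K (\<lambda>i. distr M borel (D v i))"
      using k v by (subst (asm) indep_vars_iff_distr_eq_PiM') auto
    also have "\<dots> = PiM ?K (\<lambda>i. distr M borel (X (\<rho> i - \<rho> (i - 1))))"
    proof (rule PiM_cong[OF refl])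
      fix i assume "i \<in> ?K"
      moreover have "\<rho> (i - 1) \<le> \<rho> i" using \<rho>_mono by (rule monoD) simp
      moreover have "D v i = (\<lambda>\<omega>. X (v + \<rho> i) \<omega> - X (v + \<rho> (i - 1)) \<omega>)"
        using \<open>i \<in> ?K\<close> by (intro ext D1) simp
      ultimately show "distr M borel (D v i) = distr M borel (X (\<rho> i - \<rho> (i - 1)))"
        using X_stationary[of "v + \<rho> (i - 1)" "\<rho> i - \<rho> (i - 1)"] \<rho>_nonneg[of "i - 1"] v
        by (simp add: add_ac)
    qed
    finally show ?thesis .
  qed
  \<comment> \<open>The conditions on displacements rewritten for increments: by telescoping, the
    first \<open>Suc j\<close> of them add up to the displacement at \<open>l ! j\<close>.\<close>
  define E where "E = {d \<in> space ?P. \<forall>j\<in>{..<k}. (\<Sum>i=1..Suc j. d i) \<in> A (l ! j)}"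
  have E: "E \<in> sets ?P"
  proof -
    have [measurable]: "A (l ! j) \<in> sets borel" if "j < k" for j
      using that l A by (auto simp: k_def)
    have [measurable]: "(\<lambda>d. \<Sum>i=1..Suc j. d i) \<in> borel_measurable ?P" if "j < k" for j
      using that by (intro borel_measurable_sum measurable_component_singleton) auto
    show ?thesis unfolding E_def by measurable
  qed
  have sumD: "(\<Sum>i=1..Suc j. D v i \<omega>) = X (v + l ! j) \<omega> - X v \<omega>" if "j < k" for v j \<omega>
  proof -
    have "(\<Sum>i=1..n. D v i \<omega>) = X (v + \<rho> n) \<omega> - X v \<omega>" for n
    proof (induction n)
      case (Suc n)
      then show ?case by (simp add: D1)
    qed (simp add: \<rho>_def)
    from this[of "Suc j"] show ?thesis using that by (simp add: \<rho>_def min_def)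
  qed
  have inE: "(\<lambda>i\<in>?K. D v i \<omega>) \<in> E \<longleftrightarrow> (\<forall>t\<in>J. X (v + t) \<omega> - X v \<omega> \<in> A t)" for v \<omega>
  proof -
    have "(\<Sum>i=1..Suc j. (\<lambda>i\<in>?K. D v i \<omega>) i) = X (v + l ! j) \<omega> - X v \<omega>" if "j < k" for j
      unfolding sumD[OF that, symmetric] using that by (intro sum.cong) auto
    then have "(\<lambda>i\<in>?K. D v i \<omega>) \<in> E \<longleftrightarrow> (\<forall>j<k. X (v + l ! j) \<omega> - X v \<omega> \<in> A (l ! j))"
      by (simp add: E_def space_PiM) blast
    also have "\<dots> \<longleftrightarrow> (\<forall>t\<in>J. X (v + t) \<omega> - X v \<omega> \<in> A t)"
      unfolding l(1)[symmetric] k_def by (metis in_set_conv_nth)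
    finally show ?thesis .
  qed
  have emE: "emeasure M {\<omega>\<in>space M. (\<lambda>i\<in>?K. D v i \<omega>) \<in> E}
      = emeasure (PiM ?K (\<lambda>i. distr M borel (X (\<rho> i - \<rho> (i - 1))))) E" if v: "0 \<le> v" for v
    unfolding law[OF v, symmetric] using E v
    by (subst emeasure_distr) (auto intro!: measurable_restrict arg_cong[where f="emeasure M"])
  have J_meas: "{\<omega>\<in>space M. \<forall>t\<in>J. X t \<omega> \<in> A t} \<in> sets M"
    using J A by (intro sets.sets_Collect_finite_All measurable_sets_borel) (auto simp: subset_iff)
  have D_meas': "{\<omega>\<in>space M. (\<lambda>i\<in>?K. D v i \<omega>) \<in> E} \<in> sets M" if "0 \<le> v" for v
  proof -
    have "(\<lambda>\<omega>. \<lambda>i\<in>?K. D v i \<omega>) \<in> measurable M ?P"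
      by (rule measurable_restrict) (use that in simp)
    from measurable_sets[OF this E] show ?thesis by (simp add: vimage_def Int_def conj_commute)
  qed
  have "indep_var (PiM {0} (\<lambda>_. borel)) (\<lambda>\<omega>. \<lambda>i\<in>{0}. D u i \<omega>) ?P (\<lambda>\<omega>. \<lambda>i\<in>?K. D u i \<omega>)"
    by (rule indep_var_restrict[OF indep[OF u]]) auto
  moreover have B': "{d \<in> space (PiM {0} (\<lambda>_. borel)). d (0::nat) \<in> B} \<in> sets (PiM {0} (\<lambda>_. borel :: real measure))"
    using B by measurable
  ultimately have "prob ((\<lambda>\<omega>. \<lambda>i\<in>{0}. D u i \<omega>) -` {d \<in> space (PiM {0} (\<lambda>_. borel)). d (0::nat) \<in> B} \<inter> space M \<inter>
        ((\<lambda>\<omega>. \<lambda>i\<in>?K. D u i \<omega>) -` E \<inter> space M)) =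
      prob ((\<lambda>\<omega>. \<lambda>i\<in>{0}. D u i \<omega>) -` {d \<in> space (PiM {0} (\<lambda>_. borel)). d (0::nat) \<in> B} \<inter> space M) *
      prob ((\<lambda>\<omega>. \<lambda>i\<in>?K. D u i \<omega>) -` E \<inter> space M)"
    using E unfolding indep_var_eq by (elim conjE, intro indep_setD) (assumption, (blast intro: sigma_sets.Basic)+)
  moreover have "(\<lambda>\<omega>. \<lambda>i\<in>{0}. D u i \<omega>) -` {d \<in> space (PiM {0} (\<lambda>_. borel)). d (0::nat) \<in> B} \<inter> space M
      = {\<omega>\<in>space M. D u 0 \<omega> \<in> B}"
    by (auto simp: space_PiM)
  moreover have "(\<lambda>\<omega>. \<lambda>i\<in>?K. D u i \<omega>) -` E \<inter> space M = {\<omega>\<in>space M. (\<lambda>i\<in>?K. D u i \<omega>) \<in> E}"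
    by auto
  ultimately have "prob ({\<omega>\<in>space M. D u 0 \<omega> \<in> B} \<inter> {\<omega>\<in>space M. (\<lambda>i\<in>?K. D u i \<omega>) \<in> E})
     = prob {\<omega>\<in>space M. D u 0 \<omega> \<in> B} * prob {\<omega>\<in>space M. (\<lambda>i\<in>?K. D u i \<omega>) \<in> E}"
    by (simp only:)
  moreover have "{\<omega>\<in>space M. D u 0 \<omega> \<in> B} \<inter> {\<omega>\<in>space M. (\<lambda>i\<in>?K. D u i \<omega>) \<in> E}
     = {\<omega>\<in>space M. D u 0 \<omega> \<in> B \<and> (\<lambda>i\<in>?K. D u i \<omega>) \<in> E}" by auto
  ultimately
  have "emeasure M {\<omega>\<in>space M. D u 0 \<omega> \<in> B \<and> (\<lambda>i\<in>?K. D u i \<omega>) \<in> E}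
     = emeasure M {\<omega>\<in>space M. D u 0 \<omega> \<in> B} * emeasure M {\<omega>\<in>space M. (\<lambda>i\<in>?K. D u i \<omega>) \<in> E}"
    by (simp add: emeasure_eq_measure ennreal_mult)
  moreover have "emeasure M {\<omega>\<in>space M. D u 0 \<omega> \<in> B \<and> (\<lambda>i\<in>?K. D u i \<omega>) \<in> E}
      = emeasure M {\<omega>\<in>space M. X u \<omega> \<in> B \<and> (\<lambda>i\<in>?K. D u i \<omega>) \<in> E}"
    using X_zero u B D_meas'[OF u] by (intro emeasure_eq_AE) (auto simp: D0 elim!: eventually_mono)
  moreover have "emeasure M {\<omega>\<in>space M. D u 0 \<omega> \<in> B} = emeasure M {\<omega>\<in>space M. X u \<omega> \<in> B}"
    using X_zero u B by (intro emeasure_eq_AE) (auto simp: D0 elim!: eventually_mono)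
  \<comment> \<open>Stationarity enters here: the right side of \<open>emE\<close> is free of the
    starting time, so u may be replaced by 0, where the subtracted X 0 vanishes almost
    surely.\<close>
  moreover have "emeasure M {\<omega>\<in>space M. (\<lambda>i\<in>?K. D u i \<omega>) \<in> E} = emeasure M {\<omega>\<in>space M. (\<lambda>i\<in>?K. D 0 i \<omega>) \<in> E}"
    using emE[OF u] emE[of 0] by simp
  moreover have "\<dots> = emeasure M {\<omega>\<in>space M. \<forall>t\<in>J. X t \<omega> \<in> A t}"
    unfolding inE using X_zero D_meas'[of 0, unfolded inE] J_meas
    by (intro emeasure_eq_AE) (auto elim!: eventually_mono)
  ultimately show ?thesis by (simp only: inE)
qed

text \<open>For fixed \<open>B\<close> both sides are finite measures in \<open>C\<close>. They
  agree on cylinders by \<open>finite_dimensional_shift\<close>, and cylinders determine a finite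
  measure on the infinite product.\<close>

lemma X_shifted_law:
  assumes u: "0 \<le> u"
  shows "distr M (borel \<Otimes>\<^sub>M paths) (\<lambda>\<omega>. (X u \<omega>, shifted u \<omega>)) = distr M borel (X u) \<Otimes>\<^sub>M distr M paths path"
proof (rule pair_measure_eqI[symmetric])
  note [measurable] = X_measurable[OF u] shifted_measurable[OF u]
  interpret P: prob_space "distr M paths path" by (rule prob_space_distr) simp
  interpret Z: prob_space "distr M borel (X u)" by (rule prob_space_distr) simp
  show "sigma_finite_measure (distr M paths path)" "sigma_finite_measure (distr M borel (X u))"
    by unfold_locales
  fix B C assume "B \<in> sets (distr M borel (X u))" "C \<in> sets (distr M paths path)"
  then have B [measurable]: "B \<in> sets borel" and C [measurable]: "C \<in> sets paths" by auto
  \<comment> \<open>Absorbing the event X u \<in> B into a density leaves measures on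
    \<open>paths\<close> alone, to which uniqueness on cylinders applies.\<close>
  let ?D = "density M (\<lambda>\<omega>. indicator B (X u \<omega>))"
  let ?Q1 = "distr ?D paths (shifted u)"
  let ?Q2 = "scale_measure (emeasure (distr M borel (X u)) B) (distr M paths path)"
  have Q1: "emeasure ?Q1 C = emeasure M {\<omega>\<in>space M. X u \<omega> \<in> B \<and> shifted u \<omega> \<in> C}" if [measurable]: "C \<in> sets paths" for C
  proof -
    have "emeasure ?Q1 C = (\<integral>\<^sup>+\<omega>. indicator B (X u \<omega>) * indicator (shifted u -` C \<inter> space M) \<omega> \<partial>M)"
      by (simp add: emeasure_distr emeasure_density)
    also have "\<dots> = (\<integral>\<^sup>+\<omega>. indicator {\<omega>\<in>space M. X u \<omega> \<in> B \<and> shifted u \<omega> \<in> C} \<omega> \<partial>M)"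
      by (intro nn_integral_cong) (auto simp: indicator_def)
    also have "\<dots> = emeasure M {\<omega>\<in>space M. X u \<omega> \<in> B \<and> shifted u \<omega> \<in> C}"
      by (rule nn_integral_indicator) measurable
    finally show ?thesis .
  qed
  have "?Q1 = ?Q2"
  proof (rule measure_eqI_PiM_infinite)
    show "finite_measure ?Q1"
    proof (rule finite_measureI)
      have "emeasure ?Q1 (space ?Q1) \<le> 1"
        using Q1[of "space paths"] emeasure_le_1 by simp
      then show "emeasure ?Q1 (space ?Q1) \<noteq> \<infinity>" by (auto simp: top_unique)
    qed
    fix A J assume J: "finite J" "J \<subseteq> {0::real..}" and A: "\<And>i. i \<in> J \<Longrightarrow> A i \<in> sets (borel :: real measure)"
    let ?E = "prod_emb {0..} (\<lambda>_. borel :: real measure) J (Pi\<^sub>E J A)"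
    have E [measurable]: "?E \<in> sets paths" using J A by (intro sets_PiM_I) auto
    have 1: "(\<lambda>t\<in>{0..}. y t) \<in> ?E \<longleftrightarrow> (\<forall>t\<in>J. y t \<in> A t)" for y :: "real \<Rightarrow> real"
      using J by (auto simp: prod_emb_def PiE_iff extensional_def restrict_def subset_iff)
    have "emeasure ?Q1 ?E = emeasure M {\<omega>\<in>space M. X u \<omega> \<in> B \<and> (\<forall>t\<in>J. X (u + t) \<omega> - X u \<omega> \<in> A t)}"
      by (simp add: Q1 shifted_def 1)
    also have "\<dots> = emeasure M {\<omega>\<in>space M. X u \<omega> \<in> B} * emeasure M {\<omega>\<in>space M. path \<omega> \<in> ?E}"
      unfolding path_def 1 using finite_dimensional_shift[OF J u A B] by simp
    also have "\<dots> = emeasure ?Q2 ?E"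
      by (simp add: emeasure_distr vimage_def Int_def conj_commute)
    finally show "emeasure ?Q1 ?E = emeasure ?Q2 ?E" .
  qed simp_all
  then have "emeasure ?Q1 C = emeasure ?Q2 C" by simp
  then show "emeasure (distr M borel (X u)) B * emeasure (distr M paths path) C =
      emeasure (distr M (borel \<Otimes>\<^sub>M paths) (\<lambda>\<omega>. (X u \<omega>, shifted u \<omega>))) (B \<times> C)"
    using Q1[OF C] by (simp add: emeasure_distr vimage_def Int_def conj_ac)
qed simp

text \<open>On tails this is exp (-q (u + r)) = exp (-q u) exp (-q r). The case q = 0 is included:
  an infinite lifetime stays infinite after subtracting u.\<close>

lemma \<zeta>_memoryless:
  assumes u: "0 \<le> u" and g [measurable]: "g \<in> borel_measurable borel"
  shows "(\<integral>\<^sup>+\<omega>. indicator {z. ennreal u < z} (\<zeta> \<omega>) * g (\<zeta> \<omega> - ennreal u) \<partial>M)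
    = ennreal (exp (- q * u)) * (\<integral>\<^sup>+\<omega>. g (\<zeta> \<omega>) \<partial>M)"
proof -
  let ?D = "density M (\<lambda>\<omega>. indicator {z. ennreal u < z} (\<zeta> \<omega>))"
  let ?Q1 = "distr ?D borel (\<lambda>\<omega>. \<zeta> \<omega> - ennreal u)"
  let ?Q2 = "scale_measure (ennreal (exp (- q * u))) (distr M borel \<zeta>)"
  have Q1: "emeasure ?Q1 C = emeasure M {\<omega>\<in>space M. ennreal u < \<zeta> \<omega> \<and> \<zeta> \<omega> - ennreal u \<in> C}"
    if [measurable]: "C \<in> sets borel" for C
  proof -
    have "emeasure ?Q1 C = (\<integral>\<^sup>+\<omega>. indicator {z. ennreal u < z} (\<zeta> \<omega>) * indicator ((\<lambda>\<omega>. \<zeta> \<omega> - ennreal u) -` C \<inter> space M) \<omega> \<partial>M)"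
      by (simp add: emeasure_distr emeasure_density)
    also have "\<dots> = (\<integral>\<^sup>+\<omega>. indicator {\<omega>\<in>space M. ennreal u < \<zeta> \<omega> \<and> \<zeta> \<omega> - ennreal u \<in> C} \<omega> \<partial>M)"
      by (intro nn_integral_cong) (auto simp: indicator_def)
    also have "\<dots> = emeasure M {\<omega>\<in>space M. ennreal u < \<zeta> \<omega> \<and> \<zeta> \<omega> - ennreal u \<in> C}"
      by (rule nn_integral_indicator) measurable
    finally show ?thesis .
  qed
  have "?Q1 = ?Q2"
  proof (rule distr_ennreal_eqI)
    have top: "emeasure ?Q1 UNIV = ennreal (exp (- q * u))"
      using Q1[of UNIV] \<zeta>_tail[OF u] by simp
    show "finite_measure ?Q1" by (rule finite_measureI) (use top in simp)
    show "emeasure ?Q1 UNIV = emeasure ?Q2 UNIV"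
      using top by (simp add: emeasure_distr emeasure_space_1)
    fix t :: ennreal
    show "emeasure ?Q1 {t<..} = emeasure ?Q2 {t<..}"
    proof (cases t)
      case (real r)
      have eq: "ennreal u < z \<and> t < z - ennreal u \<longleftrightarrow> ennreal (u + r) < z" for z
        using u real
        by (cases z) (auto simp: ennreal_minus ennreal_less_iff simp flip: ennreal_plus)
      have "{\<omega>\<in>space M. ennreal u < \<zeta> \<omega> \<and> \<zeta> \<omega> - ennreal u \<in> {t<..}} = {\<omega>\<in>space M. ennreal (u + r) < \<zeta> \<omega>}"
        by (intro Collect_cong conj_cong refl) (simp only: greaterThan_iff eq)
      then have "emeasure ?Q1 {t<..} = ennreal (exp (- q * (u + r)))"
        using Q1[of "{t<..}"] \<zeta>_tail[of "u + r"] u real by (simp only: add_nonneg_nonneg) simp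
      also have "\<dots> = ennreal (exp (- q * u)) * ennreal (exp (- q * r))"
        by (simp add: algebra_simps flip: ennreal_mult exp_add)
      also have "\<dots> = emeasure ?Q2 {t<..}"
        using \<zeta>_tail[of r] real by (simp add: emeasure_distr vimage_def Int_def conj_commute)
      finally show ?thesis .
    next
      case top
      then have "{t<..} = {}" by auto
      then show ?thesis by simp
    qed
  qed simp_all
  then have "(\<integral>\<^sup>+z. g z \<partial>?Q1) = (\<integral>\<^sup>+z. g z \<partial>?Q2)" by simp
  then show ?thesis
    by (simp add: nn_integral_distr nn_integral_density nn_integral_scale_measure)
qed

end

text \<open>
  Evaluation at a real time is not jointly measurable in path and time on the uncountable product;
  for right continuous paths it agrees with the limit along countable grids, which is.
\<close>

definition right_grid :: "nat \<Rightarrow> real \<Rightarrow> real" where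
  "right_grid n t = real (Suc (nat \<lfloor>real (Suc n) * t\<rfloor>)) / real (Suc n)"

definition rc_eval :: "(real \<Rightarrow> real) \<Rightarrow> real \<Rightarrow> real" where
  "rc_eval y t = lim (\<lambda>n. y (right_grid n t))"

definition path_functional :: "(real \<Rightarrow> real) \<Rightarrow> ennreal \<Rightarrow> ennreal" where
  "path_functional y z =
     (\<integral>\<^sup>+t. indicator {0..} t * indicator {z. ennreal t < z} z * ennreal (exp (- rc_eval y t)) \<partial>lborel)"

text \<open>The extra step beyond the floor puts the grid point strictly to the right of
  \<open>t\<close> even when \<open>t\<close> lies on the grid, so the limit is taken along
  \<open>at_right t\<close>.\<close>

lemma right_grid_bounds:
  assumes "0 \<le> t"
  shows "t < right_grid n t" "right_grid n t \<le> t + 1 / real (Suc n)"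
proof -
  define k where "k = real (nat \<lfloor>real (Suc n) * t\<rfloor>)"
  define N where "N = real (Suc n)"
  have N: "0 < N" by (simp add: N_def)
  have "k = of_int \<lfloor>N * t\<rfloor>" using assms by (simp add: k_def N_def)
  then have "k \<le> N * t" "N * t < k + 1" by linarith+
  moreover have "right_grid n t = (k + 1) / N" by (simp add: right_grid_def k_def N_def)
  ultimately show "t < right_grid n t" "right_grid n t \<le> t + 1 / real (Suc n)"
    using N unfolding N_def[symmetric]
    by (simp add: pos_less_divide_eq mult.commute,
        simp add: add_divide_distrib pos_divide_le_eq mult.commute)
qed

lemma right_grid_lim:
  assumes t: "0 \<le> t"
  shows "(\<lambda>n. right_grid n t) \<longlonglongrightarrow> t"
proof (rule tendsto_sandwich[where f="\<lambda>_. t" and h="\<lambda>n. t + 1 / real (Suc n)"])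
  show "(\<lambda>n. t + 1 / real (Suc n)) \<longlonglongrightarrow> t"
    using tendsto_add[OF tendsto_const[of t] LIMSEQ_inverse_real_of_nat] by (simp add: inverse_eq_divide)
  show "eventually (\<lambda>n. t \<le> right_grid n t) sequentially"
    by (intro always_eventually allI less_imp_le right_grid_bounds t)
  show "eventually (\<lambda>n. right_grid n t \<le> t + 1 / real (Suc n)) sequentially"
    by (intro always_eventually allI right_grid_bounds t)
qed simp

lemma right_grid_at_right:
  assumes t: "0 \<le> t"
  shows "filterlim (\<lambda>n. right_grid n t) (at_right t) sequentially"
  using right_grid_lim[OF t] right_grid_bounds(1)[OF t] by (auto simp: filterlim_at less_imp_neq[symmetric])

lemma rc_eval_eq:
  assumes t: "0 \<le> t" and lim: "(y \<longlongrightarrow> y t) (at_right t)"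
  shows "rc_eval y t = y t"
  using filterlim_compose[OF lim right_grid_at_right[OF t]]
  unfolding rc_eval_def by (rule limI)

text \<open>For fixed n the grid index takes countably many values, and for each of them evaluation
  is a coordinate projection; \<open>rc_eval\<close> is a limit of such maps.\<close>

lemma rc_eval_measurable:
  "(\<lambda>p. rc_eval (fst p) (snd p)) \<in> borel_measurable (PiM {0..} (\<lambda>_. borel) \<Otimes>\<^sub>M borel)"
  unfolding rc_eval_def
proof (rule borel_measurable_lim_metric)
  fix n
  have "(\<lambda>p. (\<lambda>k p. fst p (real (Suc k) / real (Suc n))) (nat \<lfloor>real (Suc n) * snd p\<rfloor>) p)
      \<in> borel_measurable (PiM {0..} (\<lambda>_. borel :: real measure) \<Otimes>\<^sub>M (borel :: real measure))"
  proof (rule measurable_compose_countable[where f="\<lambda>k p. fst p (real (Suc k) / real (Suc n))" and g="\<lambda>p. nat \<lfloor>real (Suc n) * snd p\<rfloor>"])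
    show "(\<lambda>p. fst p (real (Suc k) / real (Suc n)))
      \<in> borel_measurable (PiM {0..} (\<lambda>_. borel :: real measure) \<Otimes>\<^sub>M (borel :: real measure))" for k
      by (rule measurable_compose[OF measurable_fst measurable_component_singleton]) simp
  qed measurable
  then show "(\<lambda>p. fst p (right_grid n (snd p)))
      \<in> borel_measurable (PiM {0..} (\<lambda>_. borel :: real measure) \<Otimes>\<^sub>M (borel :: real measure))"
    by (simp add: right_grid_def)
qed

lemma rc_eval_measurable' [measurable (raw)]:
  assumes "f \<in> measurable N (PiM {0..} (\<lambda>_. borel))" "g \<in> borel_measurable N"
  shows "(\<lambda>x. rc_eval (f x) (g x)) \<in> borel_measurable N"
  using measurable_compose[OF measurable_Pair[OF assms] rc_eval_measurable] by simp

lemma path_functional_measurable [measurable (raw)]: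
  assumes f: "f \<in> measurable N (PiM {0..} (\<lambda>_. borel))" and g: "g \<in> borel_measurable N"
  shows "(\<lambda>x. path_functional (f x) (g x)) \<in> borel_measurable N"
proof -
  have "(\<lambda>p. path_functional (fst p) (snd p)) \<in> borel_measurable (PiM {0..} (\<lambda>_. borel) \<Otimes>\<^sub>M borel)"
    unfolding path_functional_def by measurable
  from measurable_compose[OF measurable_Pair[OF f g] this] show ?thesis by simp
qed

context killed_levy begin

lemma path_\<zeta>_integral:
  assumes K [measurable]: "K \<in> borel_measurable (paths \<Otimes>\<^sub>M borel)"
  shows "(\<integral>\<^sup>+\<omega>. K (path \<omega>, \<zeta> \<omega>) \<partial>M) = (\<integral>\<^sup>+\<omega>'. \<integral>\<^sup>+\<omega>. K (path \<omega>, \<zeta> \<omega>') \<partial>M \<partial>M)"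
proof -
  interpret P: prob_space "distr M paths path" by (rule prob_space_distr) simp
  interpret Z: prob_space "distr M borel \<zeta>" by (rule prob_space_distr) simp
  interpret PZ: pair_sigma_finite "distr M paths path" "distr M borel \<zeta>" by unfold_locales
  have "(\<integral>\<^sup>+\<omega>. K (path \<omega>, \<zeta> \<omega>) \<partial>M) = (\<integral>\<^sup>+p. K p \<partial>(distr M paths path \<Otimes>\<^sub>M distr M borel \<zeta>))"
    unfolding path_\<zeta>_law[symmetric] by (simp add: nn_integral_distr)
  also have "\<dots> = (\<integral>\<^sup>+z. \<integral>\<^sup>+y. K (y, z) \<partial>distr M paths path \<partial>distr M borel \<zeta>)"
    by (rule PZ.nn_integral_snd[symmetric]) simp
  also have "\<dots> = (\<integral>\<^sup>+\<omega>'. \<integral>\<^sup>+\<omega>. K (path \<omega>, \<zeta> \<omega>') \<partial>M \<partial>M)"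
    by (simp add: nn_integral_distr)
  finally show ?thesis .
qed

lemma X_shifted_integral:
  assumes u: "0 \<le> u" and K [measurable]: "K \<in> borel_measurable (borel \<Otimes>\<^sub>M paths)"
  shows "(\<integral>\<^sup>+\<omega>. K (X u \<omega>, shifted u \<omega>) \<partial>M) = (\<integral>\<^sup>+\<omega>'. \<integral>\<^sup>+\<omega>. K (X u \<omega>', path \<omega>) \<partial>M \<partial>M)"
proof -
  note [measurable] = X_measurable[OF u] shifted_measurable[OF u]
  interpret P: prob_space "distr M paths path" by (rule prob_space_distr) simp
  interpret Z: prob_space "distr M borel (X u)" by (rule prob_space_distr) simp
  have "(\<integral>\<^sup>+\<omega>. K (X u \<omega>, shifted u \<omega>) \<partial>M) = (\<integral>\<^sup>+p. K p \<partial>(distr M borel (X u) \<Otimes>\<^sub>M distr M paths path))"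
    unfolding X_shifted_law[OF u, symmetric] by (simp add: nn_integral_distr)
  also have "\<dots> = (\<integral>\<^sup>+x. \<integral>\<^sup>+y. K (x, y) \<partial>distr M paths path \<partial>distr M borel (X u))"
    by (rule P.nn_integral_fst[symmetric]) simp
  also have "\<dots> = (\<integral>\<^sup>+\<omega>'. \<integral>\<^sup>+\<omega>. K (X u \<omega>', path \<omega>) \<partial>M \<partial>M)"
    by (simp add: nn_integral_distr)
  finally show ?thesis .
qed

lemma shifted_eq_path: "0 \<le> u \<Longrightarrow> shifted u \<omega> = (\<lambda>t\<in>{0..}. path \<omega> (u + t) - path \<omega> u)"
  by (auto simp: shifted_def path_def restrict_def)

lemma path_shift_measurable [measurable]:
  "0 \<le> u \<Longrightarrow> (\<lambda>y. \<lambda>t\<in>{0..}. y (u + t) - y u) \<in> measurable paths paths"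
  by (intro measurable_restrict borel_measurable_diff measurable_component_singleton) auto

text \<open>Independence first separates the lifetime from the path. Memorylessness then restores a
  full lifetime at the price exp (-q u), and independence of increments replaces the shifted path by
  a fresh one.\<close>

lemma markov_property:
  assumes u: "0 \<le> u" and H [measurable]: "H \<in> borel_measurable (borel \<Otimes>\<^sub>M (paths \<Otimes>\<^sub>M borel))"
  shows "(\<integral>\<^sup>+\<omega>. indicator {z. ennreal u < z} (\<zeta> \<omega>) * H (X u \<omega>, shifted u \<omega>, \<zeta> \<omega> - ennreal u) \<partial>M) =
    ennreal (exp (- q * u)) * (\<integral>\<^sup>+\<omega>. \<integral>\<^sup>+\<omega>'. H (X u \<omega>, path \<omega>', \<zeta> \<omega>') \<partial>M \<partial>M)"
proof -
  note [measurable] = X_measurable[OF u] shifted_measurable[OF u] path_shift_measurable[OF u]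
  interpret MM: pair_sigma_finite M M by unfold_locales
  \<comment> \<open>The lifetime is independent of the path as a whole, so \<open>X u\<close> and
    \<open>shifted u\<close> have to be expressed as functions of it.\<close>
  have Xu: "X u \<omega> = path \<omega> u" for \<omega> using u by (simp add: path_def)
  have [measurable]: "(\<lambda>y. y u) \<in> borel_measurable paths"
    using u by (intro measurable_component_singleton) simp
  have "(\<integral>\<^sup>+\<omega>. indicator {z. ennreal u < z} (\<zeta> \<omega>) * H (X u \<omega>, shifted u \<omega>, \<zeta> \<omega> - ennreal u) \<partial>M)
    = (\<integral>\<^sup>+\<omega>'. \<integral>\<^sup>+\<omega>. indicator {z. ennreal u < z} (\<zeta> \<omega>') * H (X u \<omega>, shifted u \<omega>, \<zeta> \<omega>' - ennreal u) \<partial>M \<partial>M)"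
    unfolding Xu shifted_eq_path[OF u]
    using path_\<zeta>_integral[of "\<lambda>(y, z). indicator {z. ennreal u < z} z * H (y u, \<lambda>t\<in>{0..}. y (u + t) - y u, z - ennreal u)"]
    by simp
  also have "\<dots> = (\<integral>\<^sup>+\<omega>'. indicator {z. ennreal u < z} (\<zeta> \<omega>') * (\<integral>\<^sup>+\<omega>. H (X u \<omega>, shifted u \<omega>, \<zeta> \<omega>' - ennreal u) \<partial>M) \<partial>M)"
    by (intro nn_integral_cong nn_integral_cmult) measurable
  also have "\<dots> = ennreal (exp (- q * u)) * (\<integral>\<^sup>+\<omega>'. \<integral>\<^sup>+\<omega>. H (X u \<omega>, shifted u \<omega>, \<zeta> \<omega>') \<partial>M \<partial>M)"
    by (rule \<zeta>_memoryless[OF u, of "\<lambda>z. \<integral>\<^sup>+\<omega>. H (X u \<omega>, shifted u \<omega>, z) \<partial>M"]) measurable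
  also have "(\<integral>\<^sup>+\<omega>'. \<integral>\<^sup>+\<omega>. H (X u \<omega>, shifted u \<omega>, \<zeta> \<omega>') \<partial>M \<partial>M)
     = (\<integral>\<^sup>+\<omega>'. \<integral>\<^sup>+\<omega>. \<integral>\<^sup>+\<omega>''. H (X u \<omega>, path \<omega>'', \<zeta> \<omega>') \<partial>M \<partial>M \<partial>M)"
    by (rule nn_integral_cong)
       (use X_shifted_integral[OF u, of "\<lambda>(x, y). H (x, y, \<zeta> \<omega>')" for \<omega>'] in simp)
  \<comment> \<open>Exchanged so that, for a fixed value of X u, fresh path and fresh lifetime are
    adjacent and can be rejoined.\<close>
  also have "\<dots> = (\<integral>\<^sup>+\<omega>. \<integral>\<^sup>+\<omega>'. \<integral>\<^sup>+\<omega>''. H (X u \<omega>, path \<omega>'', \<zeta> \<omega>') \<partial>M \<partial>M \<partial>M)"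
    by (rule MM.Fubini') measurable
  also have "\<dots> = (\<integral>\<^sup>+\<omega>. \<integral>\<^sup>+\<omega>'. H (X u \<omega>, path \<omega>', \<zeta> \<omega>') \<partial>M \<partial>M)"
    by (rule nn_integral_cong)
       (use path_\<zeta>_integral[of "\<lambda>(y, z). H (X u \<omega>, y, z)" for \<omega>] in simp)
  finally show ?thesis .
qed

section \<open>The exponential functional as a function of path and lifetime\<close>

lemma X_right_continuous:
  "\<omega> \<in> space M \<Longrightarrow> 0 \<le> t \<Longrightarrow> ((\<lambda>t. X t \<omega>) \<longlongrightarrow> X t \<omega>) (at_right t)"
  using X_cadlag by (auto simp: cadlag_def)

lemma rc_eval_path:
  assumes "\<omega> \<in> space M" "0 \<le> t" shows "rc_eval (path \<omega>) t = X t \<omega>"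
proof -
  have "eventually (\<lambda>r. X r \<omega> = path \<omega> r) (at_right t)"
    using assms(2) by (auto simp: path_def eventually_at_filter intro!: always_eventually)
  then have "(path \<omega> \<longlongrightarrow> path \<omega> t) (at_right t)"
    using X_right_continuous[OF assms] assms(2) by (auto simp: path_def intro: Lim_transform_eventually)
  from rc_eval_eq[OF assms(2) this] show ?thesis using assms(2) by (simp add: path_def)
qed

lemma rc_eval_shifted:
  assumes \<omega>: "\<omega> \<in> space M" and ut: "0 \<le> u" "0 \<le> t" shows "rc_eval (shifted u \<omega>) t = X (u + t) \<omega> - X u \<omega>"
proof -
  have "filterlim (\<lambda>r. u + r) (at_right (u + t)) (at_right t)"
    by (auto simp: filterlim_at eventually_at_filter intro!: tendsto_eq_intros always_eventually)
  then have "((\<lambda>r. X (u + r) \<omega> - X u \<omega>) \<longlongrightarrow> X (u + t) \<omega> - X u \<omega>) (at_right t)"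
    using X_right_continuous[OF \<omega>, of "u + t"] ut
    by (intro tendsto_diff tendsto_const) (auto elim!: filterlim_compose)
  moreover have "eventually (\<lambda>r. X (u + r) \<omega> - X u \<omega> = shifted u \<omega> r) (at_right t)"
    using ut by (auto simp: shifted_def eventually_at_filter intro!: always_eventually)
  ultimately have "(shifted u \<omega> \<longlongrightarrow> shifted u \<omega> t) (at_right t)"
    using ut by (auto simp: shifted_def intro: Lim_transform_eventually)
  from rc_eval_eq[OF ut(2) this] show ?thesis using ut by (simp add: shifted_def)
qed

definition I :: "'a \<Rightarrow> ennreal" where "I \<omega> = path_functional (path \<omega>) (\<zeta> \<omega>)"

lemma I_measurable [measurable]: "I \<in> borel_measurable M"
  unfolding I_def[abs_def] by measurable

definition rate :: "'a \<Rightarrow> real \<Rightarrow> ennreal" where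
  "rate \<omega> t = indicator {0..} t * indicator {z. ennreal t < z} (\<zeta> \<omega>) * ennreal (exp (- rc_eval (path \<omega>) t))"

lemma rate_measurable [measurable (raw)]:
  assumes [measurable]: "f \<in> measurable N M" "g \<in> borel_measurable N"
  shows "(\<lambda>x. rate (f x) (g x)) \<in> borel_measurable N"
  unfolding rate_def by measurable

lemma I_rate: "I \<omega> = (\<integral>\<^sup>+t. rate \<omega> t \<partial>lborel)"
  by (simp add: I_def path_functional_def rate_def)

text \<open>Substituting u + t for t. This scaling lets the Markov property see the tail as a
  multiple of an independent copy of \<open>I\<close>.\<close>

lemma rate_tail:
  assumes \<omega>: "\<omega> \<in> space M" and u: "0 \<le> u" "ennreal u < \<zeta> \<omega>"
  shows "(\<integral>\<^sup>+t. rate \<omega> t * indicator {u..} t \<partial>lborel) =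
    ennreal (exp (- X u \<omega>)) * path_functional (shifted u \<omega>) (\<zeta> \<omega> - ennreal u)"
proof -
  have "(\<integral>\<^sup>+t. rate \<omega> t * indicator {u..} t \<partial>lborel) = (\<integral>\<^sup>+t. rate \<omega> (u + t) * indicator {u..} (u + t) \<partial>lborel)"
    using nn_integral_real_affine[of "\<lambda>t. rate \<omega> t * indicator {u..} t" 1 u] \<omega> by simp
  also have "\<dots> = (\<integral>\<^sup>+t. ennreal (exp (- X u \<omega>)) * (indicator {0..} t * indicator {z. ennreal t < z} (\<zeta> \<omega> - ennreal u)
      * ennreal (exp (- rc_eval (shifted u \<omega>) t))) \<partial>lborel)"
  proof (rule nn_integral_cong)
    fix t :: real
    show "rate \<omega> (u + t) * indicator {u..} (u + t) = ennreal (exp (- X u \<omega>)) * (indicator {0..} t * indicator {z. ennreal t < z} (\<zeta> \<omega> - ennreal u)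
      * ennreal (exp (- rc_eval (shifted u \<omega>) t)))"
    proof (cases "0 \<le> t")
      case True
      have "ennreal t < \<zeta> \<omega> - ennreal u \<longleftrightarrow> ennreal (u + t) < \<zeta> \<omega>"
        using u True by (cases "\<zeta> \<omega>") (auto simp: ennreal_minus ennreal_less_iff simp flip: ennreal_plus)
      then show ?thesis
        using True u \<omega> by (auto simp: rate_def rc_eval_path rc_eval_shifted indicator_def
            simp flip: ennreal_mult exp_add)
    qed simp
  qed
  also have "\<dots> = ennreal (exp (- X u \<omega>)) * path_functional (shifted u \<omega>) (\<zeta> \<omega> - ennreal u)"
    unfolding path_functional_def using u shifted_measurable[OF u(1)] \<omega>
    by (intro nn_integral_cmult) (auto dest: measurable_space)
  finally show ?thesis .
qed

end

section \<open>Moments of the exponential functional\<close>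

lemma nn_integral_exp_from_0:
  assumes "0 < (c::real)"
  shows "(\<integral>\<^sup>+t. indicator {0..} t * ennreal (exp (b - c * t)) \<partial>lborel) = ennreal (exp b / c)"
proof -
  have "(\<integral>\<^sup>+t. ennreal (exp (b - c * t)) * indicator {0..} t \<partial>lborel) = ennreal (0 - (- exp (b - c * 0) / c))"
  proof (rule nn_integral_FTC_atLeast)
    show "((\<lambda>t. - exp (b - c * t) / c) has_real_derivative exp (b - c * t)) (at t)" for t
      using assms by (auto intro!: derivative_eq_intros)
    show "((\<lambda>t. - exp (b - c * t) / c) \<longlongrightarrow> 0) at_top"
      using assms by real_asymp
  qed auto
  then show ?thesis using assms by (simp add: mult.commute)
qed

lemma exp_eq_one_plus_imp_zero:
  fixes w :: real
  assumes "exp w = 1 + w"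
  shows "w = 0"
proof -
  have "ln (exp w) = exp w - 1" using ln_exp[of w] assms by linarith
  then have "exp w = 1" by (intro ln_eq_minus_one) simp_all
  then show ?thesis by simp
qed

text \<open>The tangent inequality exp x >= 1 + x is used at (1 - t) v and -t v with weights t and 1
  - t; the linear terms cancel. Equality forces equality in a tangent inequality, hence v = 0: this
  is the strictness behind the sign of the exponent.\<close>

lemma exp_convex_combination:
  fixes v t :: real
  assumes t: "0 < t" "t < 1"
  shows "exp (t * v) \<le> 1 - t + t * exp v"
    and "exp (t * v) = 1 - t + t * exp v \<Longrightarrow> v = 0"
proof -
  define A where "A = t * (exp ((1 - t) * v) - (1 + (1 - t) * v))"
  define B where "B = (1 - t) * (exp (- t * v) - (1 + - t * v))"
  have A: "0 \<le> A" unfolding A_def using t by (intro mult_nonneg_nonneg) auto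
  have B: "0 \<le> B" unfolding B_def using t exp_ge_add_one_self[of "- t * v"] by (intro mult_nonneg_nonneg) auto
  have "exp (t * v) * exp ((1 - t) * v) = exp v" "exp (t * v) * exp (- t * v) = 1"
    by (simp_all add: algebra_simps flip: exp_add)
  moreover have "exp (t * v) * (A + B) = t * (exp (t * v) * exp ((1 - t) * v))
      + (1 - t) * (exp (t * v) * exp (- t * v)) - exp (t * v)"
    by (simp add: A_def B_def algebra_simps)
  ultimately have eq: "exp (t * v) * (A + B) = t * exp v + (1 - t) - exp (t * v)" by simp
  have "0 \<le> exp (t * v) * (A + B)" using A B by simp
  then show "exp (t * v) \<le> 1 - t + t * exp v" using eq by simp
  assume "exp (t * v) = 1 - t + t * exp v"
  then have "exp (t * v) * (A + B) = 0" using eq by simp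
  then have "A = 0" using A B by simp
  then have "exp ((1 - t) * v) = 1 + (1 - t) * v" using t by (simp add: A_def)
  then have "(1 - t) * v = 0" by (rule exp_eq_one_plus_imp_zero)
  then show "v = 0" using t by simp
qed

section \<open>Laplace transform of the unkilled process in time\<close>

context killed_levy begin

text \<open>Valued in \<open>ennreal\<close>, so that multiplicativity in time needs no
  integrability; killing contributes a separate factor exp (-q u).\<close>

definition laplace :: "real \<Rightarrow> real \<Rightarrow> ennreal" where
  "laplace p u = (\<integral>\<^sup>+\<omega>. ennreal (exp (- p * X u \<omega>)) \<partial>M)"

lemma laplace_add:
  assumes u: "0 \<le> u" and v: "0 \<le> v"
  shows "laplace p (u + v) = laplace p u * laplace p v"
proof -
  note [measurable] = X_measurable[OF u] X_measurable[OF v]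
  have [measurable]: "(\<lambda>y. y v) \<in> borel_measurable paths"
    using v by (intro measurable_component_singleton) simp
  have "laplace p (u + v) = (\<integral>\<^sup>+\<omega>. ennreal (exp (- p * X u \<omega>)) * ennreal (exp (- p * shifted u \<omega> v)) \<partial>M)"
    unfolding laplace_def using v
    by (intro nn_integral_cong) (simp add: shifted_def algebra_simps flip: ennreal_mult exp_add)
  also have "\<dots> = (\<integral>\<^sup>+\<omega>'. \<integral>\<^sup>+\<omega>. ennreal (exp (- p * X u \<omega>')) * ennreal (exp (- p * path \<omega> v)) \<partial>M \<partial>M)"
    using X_shifted_integral[OF u, of "\<lambda>(x, y). ennreal (exp (- p * x)) * ennreal (exp (- p * y v))"] by simp
  also have "\<dots> = (\<integral>\<^sup>+\<omega>'. ennreal (exp (- p * X u \<omega>')) * laplace p v \<partial>M)"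
    unfolding laplace_def using v by (intro nn_integral_cong) (simp add: path_def nn_integral_cmult)
  also have "\<dots> = laplace p u * laplace p v"
    unfolding laplace_def by (rule nn_integral_multc) measurable
  finally show ?thesis .
qed

lemma laplace_zero: "laplace p 0 = 1"
proof -
  have "laplace p 0 = (\<integral>\<^sup>+\<omega>. 1 \<partial>M)"
    unfolding laplace_def using X_zero by (intro nn_integral_cong_AE) (auto elim: eventually_mono)
  then show ?thesis by (simp add: emeasure_space_1)
qed

lemma laplace_mult: "0 \<le> u \<Longrightarrow> laplace p (real n * u) = laplace p u ^ n"
proof (induction n)
  case (Suc n)
  have "laplace p (real (Suc n) * u) = laplace p (u + real n * u)" by (simp add: algebra_simps)
  then show ?case using Suc laplace_add[of u "real n * u"] by simp
qed (simp add: laplace_zero)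

lemma laplace_rational:
  assumes a: "laplace p 1 = ennreal a" "0 < a"
  shows "laplace p (real k / real (Suc n)) = ennreal (a powr (real k / real (Suc n)))"
proof -
  define N where "N = Suc n"
  have N: "0 < N" by (simp add: N_def)
  have eq: "laplace p (1 / real N) ^ N = ennreal a"
    using laplace_mult[of "1 / real N" p N] a by (simp add: N_def)
  have "laplace p (1 / real N) \<noteq> top"
    using eq by (auto simp: N_def ennreal_top_mult ennreal_mult_top split: if_splits)
  then obtain r where r: "laplace p (1 / real N) = ennreal r" "0 \<le> r"
    by (cases "laplace p (1 / real N)") auto
  have "r ^ N = a" using eq r a by (simp add: ennreal_power)
  then have rpos: "0 < r" using r a by (auto simp: N_def less_le)
  have "a powr (1 / real N) = r"
    unfolding \<open>r ^ N = a\<close>[symmetric] using rpos N by (simp add: powr_realpow[symmetric] powr_powr)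
  then have "laplace p (1 / real N) = ennreal (a powr (1 / real N))" using r by simp
  then have "laplace p (real k * (1 / real N)) = ennreal (a powr (1 / real N)) ^ k"
    using laplace_mult[of "1 / real N" p k] by simp
  also have "\<dots> = ennreal (a powr (real k / real N))"
    using a by (simp add: ennreal_power powr_realpow[symmetric] powr_powr)
  finally show ?thesis by (simp add: N_def)
qed

text \<open>Right continuity and Fatou's lemma give only an upper bound from rational times. For the
  lower bound, take an integer m >= u: the factors at u and m - u multiply to a^m, and the second is
  at most a^(m-u).\<close>

lemma laplace_powr:
  assumes a: "laplace p 1 = ennreal a" "0 < a" and u: "0 \<le> u"
  shows "laplace p u = ennreal (a powr u)"
proof -
  have upper: "laplace p u \<le> ennreal (a powr u)" if u: "0 \<le> u" for u
  proof -
    have rg: "0 \<le> right_grid n u" for n using right_grid_bounds(1)[OF u, of n] u by simp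
    have "laplace p u = (\<integral>\<^sup>+\<omega>. liminf (\<lambda>n. ennreal (exp (- p * X (right_grid n u) \<omega>))) \<partial>M)"
      unfolding laplace_def
    proof (rule nn_integral_cong)
      fix \<omega> assume "\<omega> \<in> space M"
      then have "(\<lambda>n. X (right_grid n u) \<omega>) \<longlonglongrightarrow> X u \<omega>"
        using filterlim_compose[OF X_right_continuous right_grid_at_right[OF u]] u by blast
      then have "(\<lambda>n. ennreal (exp (- p * X (right_grid n u) \<omega>))) \<longlonglongrightarrow> ennreal (exp (- p * X u \<omega>))"
        by (intro tendsto_intros)
      then show "ennreal (exp (- p * X u \<omega>)) = liminf (\<lambda>n. ennreal (exp (- p * X (right_grid n u) \<omega>)))"
        by (intro lim_imp_Liminf[symmetric]) auto
    qed
    also have "\<dots> \<le> liminf (\<lambda>n. laplace p (right_grid n u))"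
      unfolding laplace_def using rg by (intro nn_integral_liminf) measurable
    also have "\<dots> = liminf (\<lambda>n. ennreal (a powr right_grid n u))"
      by (simp only: right_grid_def laplace_rational[OF a])
    also have "\<dots> = ennreal (a powr u)"
      using a right_grid_lim[OF u]
      by (intro lim_imp_Liminf tendsto_ennrealI tendsto_powr) auto
    finally show ?thesis .
  qed
  define m where "m = nat \<lceil>u\<rceil>"
  have m: "u \<le> real m" by (simp add: m_def real_nat_ceiling_ge)
  have "ennreal (a powr u) * ennreal (a powr (real m - u)) = ennreal (a powr real m)"
    using a by (simp add: powr_add[symmetric] flip: ennreal_mult)
  also have "\<dots> = laplace p (real m)" using laplace_rational[OF a, of m 0] by simp
  also have "\<dots> = laplace p u * laplace p (real m - u)"
    using laplace_add[of u "real m - u"] u m by simp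
  also have "\<dots> \<le> laplace p u * ennreal (a powr (real m - u))"
    using upper[of "real m - u"] m by (intro mult_left_mono) auto
  finally have "ennreal (a powr u) \<le> laplace p u"
    using a ennreal_mult_le_mult_iff[of "ennreal (a powr (real m - u))"] by (simp add: mult.commute)
  with upper[OF u] show ?thesis by (rule antisym)
qed

section \<open>Positivity and tail of the exponential functional\<close>

lemma \<zeta>_pos: "AE \<omega> in M. 0 < \<zeta> \<omega>"
proof -
  have "prob {\<omega> \<in> space M. 0 < \<zeta> \<omega>} = 1"
    using \<zeta>_tail[of 0] by (simp add: emeasure_eq_measure)
  from AE_prob_1[OF this] show ?thesis by (rule eventually_mono) simp
qed

lemma I_pos: "AE \<omega> in M. 0 < I \<omega>"
  using AE_space \<zeta>_pos
proof eventually_elim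
  fix \<omega> assume \<omega>: "\<omega> \<in> space M" and z: "0 < \<zeta> \<omega>"
  obtain r where r: "0 < r" "ennreal r \<le> \<zeta> \<omega>"
  proof (cases "\<zeta> \<omega>")
    case (real r) then show ?thesis using z that[of r] by auto
  next
    case top then show ?thesis using that[of 1] by auto
  qed
  show "0 < I \<omega>"
  proof (rule ccontr)
    assume "\<not> 0 < I \<omega>"
    then have "(\<integral>\<^sup>+t. rate \<omega> t * indicator {0<..<r} t \<partial>lborel) = 0"
      using nn_integral_mono[of lborel "\<lambda>t. rate \<omega> t * indicator {0<..<r} t" "rate \<omega>"]
      by (auto simp: I_rate not_less indicator_def)
    moreover have "(\<integral>\<^sup>+t. rate \<omega> t * indicator {0<..<r} t \<partial>lborel) =
        (\<integral>\<^sup>+t. ennreal (exp (- rc_eval (path \<omega>) t)) * indicator {0<..<r} t \<partial>lborel)"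
    proof (rule nn_integral_cong)
      fix t
      have "ennreal t < \<zeta> \<omega>" if "t \<in> {0<..<r}"
        using that by (intro less_le_trans[OF _ r(2)]) (simp add: ennreal_less_iff)
      then show "rate \<omega> t * indicator {0<..<r} t = ennreal (exp (- rc_eval (path \<omega>) t)) * indicator {0<..<r} t"
        by (auto simp: rate_def indicator_def)
    qed
    ultimately have "(\<integral>\<^sup>+t. ennreal (exp (- rc_eval (path \<omega>) t)) * indicator {0<..<r} t \<partial>lborel) = 0"
      by simp
    moreover have "(\<lambda>t. rc_eval (path \<omega>) t) \<in> borel_measurable borel"
      using measurable_space[OF path_measurable \<omega>] by measurable
    ultimately have "AE t in lborel. t \<notin> {0<..<r}"
      by (subst (asm) nn_integral_0_iff_AE) (auto simp: indicator_def elim!: eventually_mono split: if_splits)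
    then have "emeasure lborel {0<..<r} = 0"
      by (subst (asm) AE_iff_measurable[where N="{0<..<r}"]) auto
    then show False using r(1) by simp
  qed
qed

text \<open>The first-passage event of the maximal inequality on a finite grid. Path and lifetime
  are arguments so that the event can be restated for the shifted path and the remaining
  lifetime.\<close>

definition crosses :: "nat \<Rightarrow> real \<Rightarrow> real \<Rightarrow> real \<Rightarrow> (real \<Rightarrow> real) \<Rightarrow> ennreal \<Rightarrow> bool" where
  "crosses n \<delta> c x y z \<longleftrightarrow> (\<exists>k\<le>n. ennreal (real k * \<delta>) < z \<and> y (real k * \<delta>) - c * (real k * \<delta>) < - x)"

lemma crosses_measurable [measurable (raw)]:
  assumes "0 \<le> \<delta>" and f: "f \<in> borel_measurable N" and g: "g \<in> measurable N paths" and h [measurable]: "h \<in> borel_measurable N"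
  shows "Measurable.pred N (\<lambda>w. crosses n \<delta> c (f w) (g w) (h w))"
proof -
  have [measurable]: "(\<lambda>w. g w (real k * \<delta>)) \<in> borel_measurable N" for k
    by (rule measurable_compose[OF g measurable_component_singleton]) (use assms(1) in simp)
  show ?thesis unfolding crosses_def using f by measurable
qed

text \<open>Conditioning on the first step turns this maximal inequality into an induction on \<open>n\<close>.\<close>

lemma emeasure_crosses_le:
  assumes p: "0 < p" and \<delta>: "0 \<le> \<delta>" and c: "ennreal (exp (- q * \<delta>)) * laplace p \<delta> * ennreal (exp (p * c * \<delta>)) \<le> 1"
  shows "emeasure M {\<omega>\<in>space M. crosses n \<delta> c x (path \<omega>) (\<zeta> \<omega>)} \<le> ennreal (exp (- p * x))"
proof (cases "0 \<le> x")
  case False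
  then have "1 \<le> exp (- p * x)" using p by (simp add: mult_nonneg_nonpos)
  then show ?thesis using emeasure_le_1 by (metis ennreal_1 ennreal_leI order_trans)
next
  case True
  then show ?thesis
  proof (induction n arbitrary: x)
    case 0
    have "AE \<omega> in M. \<not> crosses 0 \<delta> c x (path \<omega>) (\<zeta> \<omega>)"
      using X_zero by eventually_elim (use 0 in \<open>simp add: crosses_def path_def\<close>)
    then have "emeasure M {\<omega>\<in>space M. crosses 0 \<delta> c x (path \<omega>) (\<zeta> \<omega>)} = 0"
      using \<delta> by (subst AE_iff_measurable[symmetric, OF _ refl, of M "\<lambda>\<omega>. \<not> crosses 0 \<delta> c x (path \<omega>) (\<zeta> \<omega>)", simplified]) auto
    then show ?case by simp
  next
    case (Suc n)
    note [measurable] = X_measurable[OF \<delta>] shifted_measurable[OF \<delta>]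
    \<comment> \<open>Negative levels are included because the first step may already carry the
      process past its target; the bound then exceeds 1.\<close>
    have IH: "emeasure M {\<omega>\<in>space M. crosses n \<delta> c x (path \<omega>) (\<zeta> \<omega>)} \<le> ennreal (exp (- p * x))" for x
    proof (cases "0 \<le> x")
      case False
      then have "1 \<le> exp (- p * x)" using p by (simp add: mult_nonneg_nonpos)
      then show ?thesis using emeasure_le_1 by (metis ennreal_1 ennreal_leI order_trans)
    qed (rule Suc.IH)
    \<comment> \<open>Seen from the end of the first step, the level \<open>x\<close> has become x +
      X \<delta> - c \<delta>.\<close>
    let ?H = "\<lambda>(w, y, z). indicator {w. crosses n \<delta> c (x + w - c * \<delta>) y z} w :: ennreal"
    have step: "k' \<le> n \<and> ennreal \<delta> < z \<and> ennreal (real k' * \<delta>) < z - ennreal \<delta>"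
      if "k = Suc k'" "k \<le> Suc n" "ennreal (real k * \<delta>) < z" for k k' z
    proof -
      have "real k * \<delta> = \<delta> + real k' * \<delta>" using that by (simp add: algebra_simps)
      moreover have "0 \<le> real k' * \<delta>" using \<delta> by simp
      moreover from this have "\<delta> + real k' * \<delta> < r \<Longrightarrow> \<delta> < r" for r by linarith
      ultimately show ?thesis
        using that \<delta> by (cases z) (auto simp: ennreal_minus ennreal_less_iff simp del: ennreal_plus)
    qed
    have "emeasure M {\<omega>\<in>space M. crosses (Suc n) \<delta> c x (path \<omega>) (\<zeta> \<omega>)} =
        (\<integral>\<^sup>+\<omega>. indicator {\<omega>\<in>space M. crosses (Suc n) \<delta> c x (path \<omega>) (\<zeta> \<omega>)} \<omega> \<partial>M)"
      using \<delta> by (intro nn_integral_indicator[symmetric]) measurable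
    also have "\<dots> \<le> (\<integral>\<^sup>+\<omega>. indicator {z. ennreal \<delta> < z} (\<zeta> \<omega>) * ?H (X \<delta> \<omega>, shifted \<delta> \<omega>, \<zeta> \<omega> - ennreal \<delta>) \<partial>M)"
    proof (rule nn_integral_mono_AE)
      show "AE \<omega> in M. indicator {\<omega>\<in>space M. crosses (Suc n) \<delta> c x (path \<omega>) (\<zeta> \<omega>)} \<omega>
        \<le> indicator {z. ennreal \<delta> < z} (\<zeta> \<omega>) * ?H (X \<delta> \<omega>, shifted \<delta> \<omega>, \<zeta> \<omega> - ennreal \<delta>)"
        using X_zero
      proof eventually_elim
        fix \<omega> assume X0: "X 0 \<omega> = 0"
        have "ennreal \<delta> < \<zeta> \<omega> \<and> crosses n \<delta> c (x + X \<delta> \<omega> - c * \<delta>) (shifted \<delta> \<omega>) (\<zeta> \<omega> - ennreal \<delta>)"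
          if cr: "crosses (Suc n) \<delta> c x (path \<omega>) (\<zeta> \<omega>)"
        proof -
          from cr obtain k where k: "k \<le> Suc n" "ennreal (real k * \<delta>) < \<zeta> \<omega>"
            "path \<omega> (real k * \<delta>) - c * (real k * \<delta>) < - x" by (auto simp: crosses_def)
          \<comment> \<open>The path starts at 0 and x >= 0, so the crossing needs at least one
            step.\<close>
          have "k \<noteq> 0" using k(3) X0 Suc.prems by (intro notI) (simp add: path_def)
          then obtain k' where k': "k = Suc k'" by (cases k) auto
          have "\<delta> + real k' * \<delta> = real k * \<delta>" using k' by (simp add: algebra_simps)
          then have "shifted \<delta> \<omega> (real k' * \<delta>) = path \<omega> (real k * \<delta>) - X \<delta> \<omega>"
            using \<delta> by (simp add: shifted_def path_def)
          moreover have "c * (real k * \<delta>) = c * \<delta> + c * (real k' * \<delta>)" using k' by (simp add: algebra_simps)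
          ultimately have "shifted \<delta> \<omega> (real k' * \<delta>) - c * (real k' * \<delta>) < - (x + X \<delta> \<omega> - c * \<delta>)"
            using k(3) by linarith
          then show ?thesis using step[OF k' k(1,2)] unfolding crosses_def by blast
        qed
        then show "indicator {\<omega>\<in>space M. crosses (Suc n) \<delta> c x (path \<omega>) (\<zeta> \<omega>)} \<omega>
          \<le> indicator {z. ennreal \<delta> < z} (\<zeta> \<omega>) * ?H (X \<delta> \<omega>, shifted \<delta> \<omega>, \<zeta> \<omega> - ennreal \<delta>)"
          by (auto simp: indicator_def)
      qed
    qed
    also have "\<dots> = ennreal (exp (- q * \<delta>)) * (\<integral>\<^sup>+\<omega>. \<integral>\<^sup>+\<omega>'. ?H (X \<delta> \<omega>, path \<omega>', \<zeta> \<omega>') \<partial>M \<partial>M)"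
      by (rule markov_property[OF \<delta>]) (use \<delta> in measurable)
    also have "\<dots> \<le> ennreal (exp (- q * \<delta>)) * (\<integral>\<^sup>+\<omega>. ennreal (exp (- p * (x + X \<delta> \<omega> - c * \<delta>))) \<partial>M)"
    proof (intro mult_left_mono nn_integral_mono)
      fix \<omega>
      have "(\<integral>\<^sup>+\<omega>'. ?H (X \<delta> \<omega>, path \<omega>', \<zeta> \<omega>') \<partial>M) =
          (\<integral>\<^sup>+\<omega>'. indicator {\<omega>'\<in>space M. crosses n \<delta> c (x + X \<delta> \<omega> - c * \<delta>) (path \<omega>') (\<zeta> \<omega>')} \<omega>' \<partial>M)"
        by (intro nn_integral_cong) (simp add: indicator_def)
      also have "\<dots> = emeasure M {\<omega>'\<in>space M. crosses n \<delta> c (x + X \<delta> \<omega> - c * \<delta>) (path \<omega>') (\<zeta> \<omega>')}"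
        using \<delta> by (intro nn_integral_indicator) measurable
      also have "\<dots> \<le> ennreal (exp (- p * (x + X \<delta> \<omega> - c * \<delta>)))" by (rule IH)
      finally show "(\<integral>\<^sup>+\<omega>'. ?H (X \<delta> \<omega>, path \<omega>', \<zeta> \<omega>') \<partial>M) \<le> ennreal (exp (- p * (x + X \<delta> \<omega> - c * \<delta>)))" .
    qed simp
    also have "(\<integral>\<^sup>+\<omega>. ennreal (exp (- p * (x + X \<delta> \<omega> - c * \<delta>))) \<partial>M)
        = (\<integral>\<^sup>+\<omega>. ennreal (exp (- p * x) * exp (p * c * \<delta>)) * ennreal (exp (- p * X \<delta> \<omega>)) \<partial>M)"
      by (intro nn_integral_cong) (simp add: algebra_simps flip: ennreal_mult exp_add)
    also have "\<dots> = ennreal (exp (- p * x) * exp (p * c * \<delta>)) * laplace p \<delta>"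
      unfolding laplace_def by (rule nn_integral_cmult) measurable
    also have "ennreal (exp (- q * \<delta>)) * (ennreal (exp (- p * x) * exp (p * c * \<delta>)) * laplace p \<delta>)
       = ennreal (exp (- p * x)) * (ennreal (exp (- q * \<delta>)) * laplace p \<delta> * ennreal (exp (p * c * \<delta>)))"
      by (simp add: ennreal_mult mult_ac)
    \<comment> \<open>Assumption \<open>c\<close> is the one-step supermartingale property of exp
      (-p (X_t - c t)) with killing.\<close>
    also have "\<dots> \<le> ennreal (exp (- p * x)) * 1"
      using c by (rule mult_left_mono) simp
    finally show ?case by simp
  qed
qed

text \<open>If X_t >= c t - x throughout the lifetime, then I is at most the integral of exp (x - c
  t), which is exp x / c. A larger value forces a crossing; by right continuity fine grids detect
  it, and Fatou's lemma transfers the bound.\<close>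

lemma I_tail:
  assumes p: "0 < p" and a: "laplace p 1 = ennreal a" "0 < a" "ln a < q"
  shows "emeasure M {\<omega>\<in>space M. ennreal (exp x / ((q - ln a) / p)) < I \<omega>} \<le> ennreal (exp (- p * x))"
proof -
  \<comment> \<open>For this slope the exponents -q \<delta>, \<delta> ln a and p c \<delta> cancel,
    so the one-step condition holds with equality on every mesh.\<close>
  define c where "c = (q - ln a) / p"
  have c: "0 < c" using p a by (simp add: c_def)
  have drift: "ennreal (exp (- q * \<delta>)) * laplace p \<delta> * ennreal (exp (p * c * \<delta>)) \<le> 1" if "0 \<le> \<delta>" for \<delta>
  proof -
    have "ln a + p * c - q = 0" using p by (simp add: c_def)
    moreover have "- q * \<delta> + \<delta> * ln a + p * c * \<delta> = \<delta> * (ln a + p * c - q)" by (simp add: algebra_simps)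
    ultimately have "- q * \<delta> + \<delta> * ln a + p * c * \<delta> = 0" by simp
    then have "exp (- q * \<delta>) * a powr \<delta> * exp (p * c * \<delta>) = 1"
      using a by (simp add: powr_def flip: exp_add)
    then show ?thesis
      unfolding laplace_powr[OF a(1,2) that] by (simp flip: ennreal_mult)
  qed
  \<comment> \<open>Mesh 1/(n+1) with (n+1)^2 steps reaches time n + 1: the grid becomes finer and
    its horizon longer at once.\<close>
  define C where "C n = {\<omega>\<in>space M. crosses (Suc n ^ 2) (1 / real (Suc n)) c x (path \<omega>) (\<zeta> \<omega>)}" for n
  have C_meas [measurable]: "C n \<in> sets M" for n unfolding C_def by measurable
  have C_le: "emeasure M (C n) \<le> ennreal (exp (- p * x))" for n
    unfolding C_def by (rule emeasure_crosses_le[OF p _ drift]) simp_all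
  have large: "(\<lambda>n. indicator (C n) \<omega> :: ennreal) \<longlonglongrightarrow> 1"
    if \<omega>: "\<omega> \<in> space M" and I: "ennreal (exp x / c) < I \<omega>" for \<omega>
  proof -
    have "\<exists>t\<ge>0. ennreal t < \<zeta> \<omega> \<and> X t \<omega> - c * t < - x"
    proof (rule ccontr)
      assume *: "\<not> ?thesis"
      have "I \<omega> \<le> (\<integral>\<^sup>+t. indicator {0..} t * ennreal (exp (x - c * t)) \<partial>lborel)"
        unfolding I_rate
      proof (rule nn_integral_mono)
        fix t
        have "- rc_eval (path \<omega>) t \<le> x - c * t" if "0 \<le> t" "ennreal t < \<zeta> \<omega>"
        proof -
          have "- x \<le> X t \<omega> - c * t" using * that not_le by blast
          then show ?thesis using rc_eval_path[OF \<omega> that(1)] by simp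
        qed
        then show "rate \<omega> t \<le> indicator {0..} t * ennreal (exp (x - c * t))"
          by (auto simp: rate_def indicator_def intro!: ennreal_leI)
      qed
      then show False using I nn_integral_exp_from_0[OF c, of x] by simp
    qed
    then obtain t where t: "0 \<le> t" "ennreal t < \<zeta> \<omega>" "X t \<omega> - c * t < - x" by blast
    note lim = right_grid_lim[OF t(1)]
    have "(\<lambda>n. ennreal (right_grid n t)) \<longlonglongrightarrow> ennreal t" by (intro tendsto_intros lim)
    then have ev1: "eventually (\<lambda>n. ennreal (right_grid n t) < \<zeta> \<omega>) sequentially"
      using t(2) by (rule order_tendstoD)
    have "(\<lambda>n. X (right_grid n t) \<omega> - c * right_grid n t) \<longlonglongrightarrow> X t \<omega> - c * t"
      by (intro tendsto_intros lim filterlim_compose[OF X_right_continuous right_grid_at_right] \<omega> t)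
    then have ev2: "eventually (\<lambda>n. X (right_grid n t) \<omega> - c * right_grid n t < - x) sequentially"
      using t(3) by (rule order_tendstoD)
    have ev3: "eventually (\<lambda>n. t \<le> real n) sequentially"
      by (rule eventually_sequentiallyI[of "nat \<lceil>t\<rceil>"]) linarith
    have "eventually (\<lambda>n. \<omega> \<in> C n) sequentially"
      using ev1 ev2 ev3
    proof eventually_elim
      case (elim n)
      define k where "k = Suc (nat \<lfloor>real (Suc n) * t\<rfloor>)"
      have rg: "right_grid n t = real k * (1 / real (Suc n))" by (simp add: right_grid_def k_def)
      have "right_grid n t \<le> real (Suc n)"
      proof -
        have "1 / real (Suc n) \<le> 1" by simp
        then show ?thesis using right_grid_bounds(2)[OF t(1), of n] elim(3) by linarith
      qed
      then have "real k \<le> real (Suc n) * real (Suc n)" by (simp add: rg pos_divide_le_eq)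
      then have "k \<le> Suc n ^ 2" by (metis of_nat_le_iff of_nat_mult power2_eq_square)
      moreover have "path \<omega> (right_grid n t) = X (right_grid n t) \<omega>"
        using right_grid_bounds(1)[OF t(1), of n] t(1) by (simp add: path_def)
      ultimately show ?case using elim \<omega> unfolding C_def crosses_def rg by auto
    qed
    then have "eventually (\<lambda>n. indicator (C n) \<omega> = (1::ennreal)) sequentially"
      by eventually_elim simp
    then show ?thesis by (rule tendsto_eventually)
  qed
  have "emeasure M {\<omega>\<in>space M. ennreal (exp x / c) < I \<omega>} =
      (\<integral>\<^sup>+\<omega>. indicator {\<omega>\<in>space M. ennreal (exp x / c) < I \<omega>} \<omega> \<partial>M)"
    by (intro nn_integral_indicator[symmetric]) measurable
  also have "\<dots> \<le> (\<integral>\<^sup>+\<omega>. liminf (\<lambda>n. indicator (C n) \<omega>) \<partial>M)"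
  proof (rule nn_integral_mono)
    fix \<omega>
    show "indicator {\<omega>\<in>space M. ennreal (exp x / c) < I \<omega>} \<omega> \<le> liminf (\<lambda>n. indicator (C n) \<omega> :: ennreal)"
      using lim_imp_Liminf[OF _ large[of \<omega>]] by (auto simp: indicator_def[of "{\<omega>\<in>space M. ennreal (exp x / c) < I \<omega>}"])
  qed
  also have "\<dots> \<le> liminf (\<lambda>n. \<integral>\<^sup>+\<omega>. indicator (C n) \<omega> \<partial>M)"
    by (rule nn_integral_liminf) measurable
  also have "\<dots> \<le> liminf (\<lambda>n. ennreal (exp (- p * x)))"
    using C_le by (intro Liminf_mono always_eventually) simp
  also have "\<dots> = ennreal (exp (- p * x))" by (simp add: Liminf_const)
  finally show ?thesis unfolding c_def .
qed

lemma I_finite: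
  assumes p: "0 < p" and a: "laplace p 1 = ennreal a" "0 < a" "ln a < q"
  shows "AE \<omega> in M. I \<omega> < top"
proof -
  have "emeasure M {\<omega>\<in>space M. I \<omega> = top} \<le> ennreal (exp (- p * real n))" for n :: nat
  proof -
    have "emeasure M {\<omega>\<in>space M. I \<omega> = top} \<le>
        emeasure M {\<omega>\<in>space M. ennreal (exp (real n) / ((q - ln a) / p)) < I \<omega>}"
      by (intro emeasure_mono) auto
    then show ?thesis using I_tail[OF assms, of "real n"] by (rule order_trans)
  qed
  moreover have "(\<lambda>n. ennreal (exp (- p * real n))) \<longlonglongrightarrow> ennreal 0"
    using p by (intro tendsto_ennrealI) real_asymp
  ultimately have "emeasure M {\<omega>\<in>space M. I \<omega> = top} \<le> 0"
    by (intro LIMSEQ_le_const[of _ _ "emeasure M {\<omega>\<in>space M. I \<omega> = top}"]) auto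
  then have "emeasure M {\<omega>\<in>space M. I \<omega> = top} = 0" by simp
  then show ?thesis by (subst AE_iff_measurable[OF _ refl]) (auto simp: not_less top_unique)
qed

text \<open>Dyadic decomposition: on the layer up to 2^(j+1) the r-th power is at most 2^(r (j+1)),
  while the tail bound decays like 2^(-p j); the series is geometric with ratio 2^(r-p) < 1.\<close>

lemma I_moment_finite:
  assumes p: "0 < p" and a: "laplace p 1 = ennreal a" "0 < a" "ln a < q" and r: "0 < r" "r < p"
  shows "(\<integral>\<^sup>+\<omega>. ennreal (enn2real (I \<omega>) powr r) \<partial>M) < top"
proof -
  define c where "c = (q - ln a) / p"
  have c: "0 < c" using p a by (simp add: c_def)
  let ?A = "\<lambda>j::nat. {\<omega>\<in>space M. ennreal (2 ^ j) < I \<omega>}"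
  have tail: "emeasure M (?A j) \<le> ennreal (c powr (- p) * (2 powr (- p)) ^ j)" for j
  proof -
    define x where "x = ln (c * 2 ^ j)"
    have "exp x / c = 2 ^ j" using c by (simp add: x_def)
    then have "emeasure M (?A j) \<le> ennreal (exp (- p * x))"
      using I_tail[OF p a, of x] by (simp add: c_def)
    also have "exp (- p * x) = (c * 2 ^ j) powr (- p)"
      using c by (simp add: x_def powr_def)
    also have "\<dots> = c powr (- p) * (2 powr real j) powr (- p)"
      using c by (simp add: powr_mult powr_realpow)
    also have "(2 powr real j) powr (- p) = (2 powr (- p)) ^ j"
      by (simp add: powr_realpow[symmetric] powr_powr mult.commute)
    finally show ?thesis .
  qed
  have bound: "ennreal (enn2real (I \<omega>) powr r) \<le> 1 + (\<Sum>j. ennreal (2 powr (r * (real j + 1))) * indicator (?A j) \<omega>)"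
    if \<omega>: "\<omega> \<in> space M" "I \<omega> < top" for \<omega>
  proof -
    obtain y where y: "I \<omega> = ennreal y" "0 \<le> y" using \<omega> by (cases "I \<omega>") auto
    show ?thesis
    proof (cases "y \<le> 1")
      case True
      then have "y powr r \<le> 1" using y r by (simp add: powr_le1)
      then have "ennreal (enn2real (I \<omega>) powr r) \<le> 1" using y by (metis enn2real_ennreal ennreal_1 ennreal_leI)
      then show ?thesis by (rule order_trans) (rule le_iff_add[THEN iffD2], blast)
    next
      case False
      \<comment> \<open>The largest integer strictly below \<open>log 2 y\<close>, so 2^j < y <=
        2^(j+1); strictness on the left matches the event \<open>?A j\<close>.\<close>
      define j where "j = nat (\<lceil>log 2 y\<rceil> - 1)"
      have l: "0 < log 2 y" using False by simp
      then have j: "real j < log 2 y" "log 2 y \<le> real j + 1" unfolding j_def by linarith+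
      have "2 powr real j < y" using j(1) False by (subst (asm) less_log_iff) auto
      then have "(2::real) ^ j < y" by (simp add: powr_realpow)
      then have in_A: "\<omega> \<in> ?A j" using y \<omega> by (simp add: ennreal_less_iff)
      have "y powr r \<le> (2 powr (real j + 1)) powr r"
        using False j(2) r by (intro powr_mono2) (auto simp: log_le_iff)
      also have "\<dots> = 2 powr (r * (real j + 1))" by (simp add: powr_powr mult.commute)
      finally have "ennreal (enn2real (I \<omega>) powr r) \<le> ennreal (2 powr (r * (real j + 1))) * indicator (?A j) \<omega>"
        using y in_A by (simp add: ennreal_leI)
      also have "\<dots> \<le> (\<Sum>j. ennreal (2 powr (r * (real j + 1))) * indicator (?A j) \<omega>)"
      proof -
        have "f j \<le> suminf f" for f :: "nat \<Rightarrow> ennreal"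
          using sum_le_suminf[of f "{j}"] by simp
        then show ?thesis .
      qed
      finally show ?thesis by (simp add: add_increasing)
    qed
  qed
  have "(\<integral>\<^sup>+\<omega>. ennreal (enn2real (I \<omega>) powr r) \<partial>M)
      \<le> (\<integral>\<^sup>+\<omega>. 1 + (\<Sum>j. ennreal (2 powr (r * (real j + 1))) * indicator (?A j) \<omega>) \<partial>M)"
    using I_finite[OF p a] AE_space by (intro nn_integral_mono_AE, eventually_elim) (rule bound)
  also have "\<dots> = 1 + (\<Sum>j. ennreal (2 powr (r * (real j + 1))) * emeasure M (?A j))"
    by (simp add: nn_integral_add nn_integral_suminf nn_integral_cmult emeasure_space_1)
  also have "\<dots> \<le> 1 + (\<Sum>j. ennreal (2 powr r * c powr (- p) * (2 powr (r - p)) ^ j))"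
  proof (intro add_left_mono suminf_le allI)
    fix j
    have "ennreal (2 powr (r * (real j + 1))) * emeasure M (?A j)
        \<le> ennreal (2 powr (r * (real j + 1))) * ennreal (c powr (- p) * (2 powr (- p)) ^ j)"
      by (intro mult_left_mono tail) simp
    also have "\<dots> = ennreal (2 powr r * c powr (- p) * (2 powr (r - p)) ^ j)"
      by (simp add: powr_realpow[symmetric] powr_powr powr_add[symmetric] algebra_simps flip: ennreal_mult)
    finally show "ennreal (2 powr (r * (real j + 1))) * emeasure M (?A j)
        \<le> ennreal (2 powr r * c powr (- p) * (2 powr (r - p)) ^ j)" .
  qed simp_all
  also have "\<dots> = 1 + ennreal (\<Sum>j. 2 powr r * c powr (- p) * (2 powr (r - p)) ^ j)"
  proof -
    have "(2::real) powr (r - p) < 1" using r by (simp add: powr_less_one)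
    then have "summable (\<lambda>j. 2 powr r * c powr (- p) * (2 powr (r - p)) ^ j)"
      by (intro summable_mult summable_geometric) simp
    then show ?thesis by (subst suminf_ennreal2) auto
  qed
  also have "\<dots> < top" by simp
  finally show ?thesis .
qed

text \<open>Stated in \<open>ennreal\<close>, with no finiteness of moments assumed, so that it can
  also be read from left to right to bound the lower moment. The time integral of exp (-q u) a^u
  contributes the factor 1/(q - ln a).\<close>

lemma I_moment_recurrence:
  assumes fin: "AE \<omega> in M. I \<omega> < top" and s: "0 < s"
    and a: "laplace s 1 = ennreal a" "0 < a" "ln a < q"
  shows "(\<integral>\<^sup>+\<omega>. ennreal (enn2real (I \<omega>) powr s) \<partial>M) =
    ennreal (s / (q - ln a)) * (\<integral>\<^sup>+\<omega>. ennreal (enn2real (I \<omega>) powr (s - 1)) \<partial>M)"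
proof -
  interpret Fub: pair_sigma_finite M lborel by unfold_locales
  define m where "m = (\<integral>\<^sup>+\<omega>. ennreal (enn2real (I \<omega>) powr (s - 1)) \<partial>M)"
  define T where "T \<omega> u = (\<integral>\<^sup>+t. rate \<omega> t * indicator {u..} t \<partial>lborel)" for \<omega> u
  have [measurable]: "(\<lambda>x. T (fst x) (snd x)) \<in> borel_measurable (M \<Otimes>\<^sub>M borel)"
    unfolding T_def atLeast_def by measurable
  have "(\<integral>\<^sup>+\<omega>. ennreal (enn2real (I \<omega>) powr s) \<partial>M) =
      (\<integral>\<^sup>+\<omega>. (\<integral>\<^sup>+u. ennreal s * (rate \<omega> u * ennreal (enn2real (T \<omega> u) powr (s - 1))) \<partial>lborel) \<partial>M)"
  proof (rule nn_integral_cong_AE)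
    show "AE \<omega> in M. ennreal (enn2real (I \<omega>) powr s) =
        (\<integral>\<^sup>+u. ennreal s * (rate \<omega> u * ennreal (enn2real (T \<omega> u) powr (s - 1))) \<partial>lborel)"
      using fin AE_space
    proof eventually_elim
      case (elim \<omega>)
      obtain y where y: "I \<omega> = ennreal y" "0 \<le> y" using elim by (cases "I \<omega>") auto
      have [measurable]: "rate \<omega> \<in> borel_measurable borel" using elim by measurable
      have [measurable]: "T \<omega> \<in> borel_measurable borel" unfolding T_def[abs_def] atLeast_def by measurable
      have "(\<integral>\<^sup>+u. rate \<omega> u * ennreal (enn2real (T \<omega> u) powr (s - 1)) \<partial>lborel) = ennreal (y powr s / s)"
        unfolding T_def using y s by (intro nn_integral_tail_powr) (auto simp: I_rate)
      moreover have "(\<integral>\<^sup>+u. ennreal s * (rate \<omega> u * ennreal (enn2real (T \<omega> u) powr (s - 1))) \<partial>lborel) =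
          ennreal s * (\<integral>\<^sup>+u. rate \<omega> u * ennreal (enn2real (T \<omega> u) powr (s - 1)) \<partial>lborel)"
        by (rule nn_integral_cmult) measurable
      ultimately show ?case using y s by (simp flip: ennreal_mult)
    qed
  qed
  also have "\<dots> = (\<integral>\<^sup>+u. (\<integral>\<^sup>+\<omega>. ennreal s * (rate \<omega> u * ennreal (enn2real (T \<omega> u) powr (s - 1))) \<partial>M) \<partial>lborel)"
    by (rule Fub.Fubini'[symmetric]) measurable
  also have "\<dots> = (\<integral>\<^sup>+u. ennreal s * m * (indicator {0..} u * ennreal (exp (0 - (q - ln a) * u))) \<partial>lborel)"
  proof (rule nn_integral_cong)
    fix u :: real
    show "(\<integral>\<^sup>+\<omega>. ennreal s * (rate \<omega> u * ennreal (enn2real (T \<omega> u) powr (s - 1))) \<partial>M) =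
        ennreal s * m * (indicator {0..} u * ennreal (exp (0 - (q - ln a) * u)))"
    proof (cases "0 \<le> u")
      case True
      note [measurable] = X_measurable[OF True]
      let ?H = "\<lambda>(x, y, z). ennreal s * (ennreal (exp (- x)) * ennreal (enn2real (ennreal (exp (- x)) * path_functional y z) powr (s - 1)))"
      have "(\<integral>\<^sup>+\<omega>. ennreal s * (rate \<omega> u * ennreal (enn2real (T \<omega> u) powr (s - 1))) \<partial>M) =
          (\<integral>\<^sup>+\<omega>. indicator {z. ennreal u < z} (\<zeta> \<omega>) * ?H (X u \<omega>, shifted u \<omega>, \<zeta> \<omega> - ennreal u) \<partial>M)"
      proof (rule nn_integral_cong)
        fix \<omega> assume \<omega>: "\<omega> \<in> space M"
        show "ennreal s * (rate \<omega> u * ennreal (enn2real (T \<omega> u) powr (s - 1))) =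
          indicator {z. ennreal u < z} (\<zeta> \<omega>) * ?H (X u \<omega>, shifted u \<omega>, \<zeta> \<omega> - ennreal u)"
        proof (cases "ennreal u < \<zeta> \<omega>")
          case survives: True
          show ?thesis using rate_tail[OF \<omega> True survives] True survives \<omega> by (simp add: T_def rate_def rc_eval_path)
        qed (simp add: rate_def)
      qed
      also have "\<dots> = ennreal (exp (- q * u)) * (\<integral>\<^sup>+\<omega>. \<integral>\<^sup>+\<omega>'. ?H (X u \<omega>, path \<omega>', \<zeta> \<omega>') \<partial>M \<partial>M)"
        by (rule markov_property[OF True]) measurable
      also have "(\<integral>\<^sup>+\<omega>. \<integral>\<^sup>+\<omega>'. ?H (X u \<omega>, path \<omega>', \<zeta> \<omega>') \<partial>M \<partial>M) =
          (\<integral>\<^sup>+\<omega>. ennreal (exp (- s * X u \<omega>)) * (ennreal s * m) \<partial>M)"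
      proof (rule nn_integral_cong)
        fix \<omega>
        have "(\<integral>\<^sup>+\<omega>'. ?H (X u \<omega>, path \<omega>', \<zeta> \<omega>') \<partial>M) =
            (\<integral>\<^sup>+\<omega>'. ennreal (exp (- s * X u \<omega>)) * ennreal s * ennreal (enn2real (I \<omega>') powr (s - 1)) \<partial>M)"
        proof (rule nn_integral_cong)
          fix \<omega>'
          \<comment> \<open>One factor exp (-X u) from the rate and s - 1 from the power of the tail
            combine to the integrand of \<open>laplace s u\<close>.\<close>
          have "exp (- X u \<omega>) * (exp (- X u \<omega>) * enn2real (I \<omega>')) powr (s - 1) =
              exp (- s * X u \<omega>) * enn2real (I \<omega>') powr (s - 1)"
            by (simp add: powr_mult exp_powr_real algebra_simps flip: exp_add)
          then show "?H (X u \<omega>, path \<omega>', \<zeta> \<omega>') = ennreal (exp (- s * X u \<omega>)) * ennreal s * ennreal (enn2real (I \<omega>') powr (s - 1))"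
            using s by (simp add: I_def[symmetric] enn2real_mult mult_ac flip: ennreal_mult')
        qed
        also have "\<dots> = ennreal (exp (- s * X u \<omega>)) * ennreal s * m"
          unfolding m_def by (rule nn_integral_cmult) measurable
        finally show "(\<integral>\<^sup>+\<omega>'. ?H (X u \<omega>, path \<omega>', \<zeta> \<omega>') \<partial>M) = ennreal (exp (- s * X u \<omega>)) * (ennreal s * m)"
          by (simp add: mult.assoc)
      qed
      also have "\<dots> = laplace s u * (ennreal s * m)"
        unfolding laplace_def by (rule nn_integral_multc) measurable
      also have "laplace s u = ennreal (exp (u * ln a))"
        using laplace_powr[OF a(1,2) True] a by (simp add: powr_def)
      also have "ennreal (exp (- q * u)) * (ennreal (exp (u * ln a)) * (ennreal s * m)) =
          ennreal s * m * (ennreal (exp (- q * u)) * ennreal (exp (u * ln a)))"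
        by (simp add: mult_ac)
      also have "ennreal (exp (- q * u)) * ennreal (exp (u * ln a)) = ennreal (exp (0 - (q - ln a) * u))"
        by (simp add: algebra_simps flip: ennreal_mult exp_add)
      finally show ?thesis using True by simp
    qed (simp add: rate_def)
  qed
  also have "\<dots> = ennreal s * m * (\<integral>\<^sup>+u. indicator {0..} u * ennreal (exp (0 - (q - ln a) * u)) \<partial>lborel)"
    by (rule nn_integral_cmult) measurable
  also have "\<dots> = ennreal s * m * ennreal (1 / (q - ln a))"
    using nn_integral_exp_from_0[of "q - ln a" 0] a by simp
  also have "\<dots> = ennreal (s / (q - ln a)) * m"
    using s a by (simp add: mult_ac divide_inverse flip: ennreal_mult)
  finally show ?thesis by (simp add: m_def)
qed


section \<open>Sign of the Laplace exponent between 0 and the Cramer root\<close>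

lemma laplace_one_pos: "laplace p 1 \<noteq> 0"
proof
  assume "laplace p 1 = 0"
  then have "AE \<omega> in M. False"
    unfolding laplace_def by (subst (asm) nn_integral_0_iff_AE) auto
  then show False by (simp add: AE_False emeasure_space_1)
qed

text \<open>Strict Jensen for V = -\<theta> X_1 - q, whose exponential has mean 1: with t =
  s/\<theta> the mean of exp (t V) is at most 1, so ln a <= t q <= q. Equality throughout forces q =
  0 and then V = 0 almost surely, against \<open>mean\<close>.\<close>

lemma laplace_exponent_neg:
  assumes \<theta>: "0 < s" "s < \<theta>" and crit: "laplace \<theta> 1 = ennreal (exp q)"
    and mean: "q = 0 \<Longrightarrow> \<not> (AE \<omega> in M. X 1 \<omega> = 0)"
    and a: "laplace s 1 = ennreal a" "0 < a"
  shows "ln a < q"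
proof -
  define t where "t = s / \<theta>"
  have t: "0 < t" "t < 1" "t * \<theta> = s" using \<theta> by (auto simp: t_def)
  define V where "V \<omega> = - \<theta> * X 1 \<omega> - q" for \<omega>
  have [measurable]: "V \<in> borel_measurable M" unfolding V_def[abs_def] by measurable
  have "(\<integral>\<^sup>+\<omega>. ennreal (exp (V \<omega>)) \<partial>M) = (\<integral>\<^sup>+\<omega>. ennreal (exp (- q)) * ennreal (exp (- \<theta> * X 1 \<omega>)) \<partial>M)"
    by (intro nn_integral_cong) (simp add: V_def flip: ennreal_mult exp_add)
  also have "\<dots> = ennreal (exp (- q)) * laplace \<theta> 1"
    unfolding laplace_def by (rule nn_integral_cmult) measurable
  also have "\<dots> = 1" by (simp add: crit flip: ennreal_mult exp_add)
  finally have V: "(\<integral>\<^sup>+\<omega>. ennreal (exp (V \<omega>)) \<partial>M) = ennreal 1" by simp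
  then have intV: "integrable M (\<lambda>\<omega>. exp (V \<omega>))" and EV: "(\<integral>\<omega>. exp (V \<omega>) \<partial>M) = 1"
    using integrableI_nn_integral_finite[of "\<lambda>\<omega>. exp (V \<omega>)" M 1] integral_eq_nn_integral[of "\<lambda>\<omega>. exp (V \<omega>)" M]
    by auto
  have tV: "t * V \<omega> = - s * X 1 \<omega> - t * q" for \<omega>
    by (simp add: V_def algebra_simps flip: t(3))
  have "(\<integral>\<^sup>+\<omega>. ennreal (exp (t * V \<omega>)) \<partial>M) = (\<integral>\<^sup>+\<omega>. ennreal (exp (- t * q)) * ennreal (exp (- s * X 1 \<omega>)) \<partial>M)"
    by (intro nn_integral_cong) (simp add: tV flip: ennreal_mult exp_add)
  also have "\<dots> = ennreal (exp (- t * q)) * laplace s 1"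
    unfolding laplace_def by (rule nn_integral_cmult) measurable
  also have "\<dots> = ennreal (exp (- t * q) * a)" using a by (simp add: ennreal_mult)
  finally have V': "(\<integral>\<^sup>+\<omega>. ennreal (exp (t * V \<omega>)) \<partial>M) = ennreal (exp (- t * q) * a)" .
  then have inttV: "integrable M (\<lambda>\<omega>. exp (t * V \<omega>))" and EtV: "(\<integral>\<omega>. exp (t * V \<omega>) \<partial>M) = exp (- t * q) * a"
    using integrableI_nn_integral_finite[of "\<lambda>\<omega>. exp (t * V \<omega>)" M "exp (- t * q) * a"]
      integral_eq_nn_integral[of "\<lambda>\<omega>. exp (t * V \<omega>)" M] a
    by auto
  \<comment> \<open>The pointwise Jensen gap, nonnegative and zero only where V vanishes.\<close>
  define G where "G \<omega> = 1 - t + t * exp (V \<omega>) - exp (t * V \<omega>)" for \<omega>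
  have G: "0 \<le> G \<omega>" for \<omega> using exp_convex_combination(1)[OF t(1,2)] by (simp add: G_def)
  have intG: "integrable M G" unfolding G_def[abs_def] using intV inttV by simp
  have EG: "(\<integral>\<omega>. G \<omega> \<partial>M) = 1 - exp (- t * q) * a"
    unfolding G_def using intV inttV by (simp add: EV EtV prob_space)
  have "0 \<le> (\<integral>\<omega>. G \<omega> \<partial>M)" using G by simp
  then have le: "exp (- t * q) * a \<le> 1" using EG by simp
  have ln: "ln (exp (- t * q) * a) = ln a - t * q" using a by (simp add: ln_mult)
  have "exp (- t * q) * a > 0" using a by simp
  then have "ln a - t * q \<le> 0" using le unfolding ln[symmetric] by simp
  moreover have "t * q \<le> q" using t q by (simp add: mult_left_le_one_le)
  ultimately have "ln a \<le> q" by simp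
  moreover have "ln a \<noteq> q"
  proof
    assume "ln a = q"
    then have "q \<le> t * q" using \<open>ln a - t * q \<le> 0\<close> by simp
    then have "(1 - t) * q \<le> 0" by (simp add: algebra_simps)
    then have "q = 0" using t q by (simp add: mult_le_0_iff)
    then have "a = 1" using \<open>ln a = q\<close> a by simp
    then have "(\<integral>\<omega>. G \<omega> \<partial>M) = 0" using EG \<open>q = 0\<close> by simp
    then have "AE \<omega> in M. G \<omega> = 0" using integral_nonneg_eq_0_iff_AE[OF intG] G by simp
    then have "AE \<omega> in M. X 1 \<omega> = 0"
    proof eventually_elim
      case (elim \<omega>)
      then have "V \<omega> = 0" using exp_convex_combination(2)[OF t(1,2), of "V \<omega>"] by (simp add: G_def)
      then show ?case using \<open>q = 0\<close> \<theta> by (simp add: V_def)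
    qed
    then show False using mean \<open>q = 0\<close> by blast
  qed
  ultimately show ?thesis by simp
qed

section \<open>From the killed process to the unkilled one\<close>

lemma killed_exp_integral:
  assumes Y: "\<forall>\<omega>\<in>space M. \<forall>t\<ge>0. Y t \<omega> = (if ennreal t < \<zeta> \<omega> then Some (X t \<omega>) else None)"
  shows "(\<integral>\<^sup>+\<omega>. ennreal (killed_exp (- p) (Y 1 \<omega>)) \<partial>M) = ennreal (exp (- q)) * laplace p 1"
    and "(\<lambda>\<omega>. killed_exp (- p) (Y 1 \<omega>)) \<in> borel_measurable M"
proof -
  have eq: "killed_exp (- p) (Y 1 \<omega>) = indicator {z. ennreal 1 < z} (\<zeta> \<omega>) * exp (- p * X 1 \<omega>)" if "\<omega> \<in> space M" for \<omega>
    using Y that by (simp add: killed_exp_def)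
  have "(\<integral>\<^sup>+\<omega>. ennreal (killed_exp (- p) (Y 1 \<omega>)) \<partial>M) =
      (\<integral>\<^sup>+\<omega>. indicator {z. ennreal 1 < z} (\<zeta> \<omega>) * (\<lambda>(x, y, z). ennreal (exp (- p * x))) (X 1 \<omega>, shifted 1 \<omega>, \<zeta> \<omega> - ennreal 1) \<partial>M)"
    by (intro nn_integral_cong) (auto simp: eq indicator_def)
  \<comment> \<open>The Markov property at time 1, for a function of X 1 alone, separates survival
    past time 1 from the value of X.\<close>
  also have "\<dots> = ennreal (exp (- q * 1)) * (\<integral>\<^sup>+\<omega>. \<integral>\<^sup>+\<omega>'. ennreal (exp (- p * X 1 \<omega>)) \<partial>M \<partial>M)"
    by (subst markov_property) auto
  also have "\<dots> = ennreal (exp (- q)) * laplace p 1"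
    by (simp add: laplace_def emeasure_space_1)
  finally show "(\<integral>\<^sup>+\<omega>. ennreal (killed_exp (- p) (Y 1 \<omega>)) \<partial>M) = ennreal (exp (- q)) * laplace p 1" .
  have "(\<lambda>\<omega>. indicator {z. ennreal 1 < z} (\<zeta> \<omega>) * exp (- p * X 1 \<omega>)) \<in> borel_measurable M"
    by measurable
  then show "(\<lambda>\<omega>. killed_exp (- p) (Y 1 \<omega>)) \<in> borel_measurable M"
    by (subst measurable_cong[OF eq]) auto
qed

lemma killed_exp_nonneg: "0 \<le> killed_exp z y"
  by (auto simp: killed_exp_def split: option.split)

lemma laplace_exponent_eq:
  assumes Y: "\<forall>\<omega>\<in>space M. \<forall>t\<ge>0. Y t \<omega> = (if ennreal t < \<zeta> \<omega> then Some (X t \<omega>) else None)"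
    and a: "laplace p 1 = ennreal a" "0 < a"
  shows "laplace_exponent M Y (- p) = ln a - q"
proof -
  have "(\<integral>\<omega>. killed_exp (- p) (Y 1 \<omega>) \<partial>M) = enn2real (ennreal (exp (- q)) * ennreal a)"
    using killed_exp_integral[OF Y, of p] a
    by (subst integral_eq_nn_integral) (auto simp: killed_exp_nonneg)
  also have "\<dots> = exp (- q) * a" using a by (simp flip: ennreal_mult)
  finally show ?thesis using a by (simp add: laplace_exponent_def ln_mult)
qed

lemma laplace_finite_of_exponent:
  assumes Y: "\<forall>\<omega>\<in>space M. \<forall>t\<ge>0. Y t \<omega> = (if ennreal t < \<zeta> \<omega> then Some (X t \<omega>) else None)"
    and fin: "laplace_exponent_finite M Y (- p)"
  shows "\<exists>a>0. laplace p 1 = ennreal a"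
proof -
  have "(\<integral>\<^sup>+\<omega>. ennreal (norm (killed_exp (- p) (Y 1 \<omega>))) \<partial>M) < \<infinity>"
    using fin by (simp add: laplace_exponent_finite_def integrable_iff_bounded)
  then have "ennreal (exp (- q)) * laplace p 1 < top"
    using killed_exp_integral(1)[OF Y, of p] killed_exp_nonneg by simp
  then have "laplace p 1 \<noteq> top" by (auto simp: ennreal_mult_top)
  then obtain a where "laplace p 1 = ennreal a" "0 \<le> a" by (cases "laplace p 1") auto
  with laplace_one_pos[of p] show ?thesis by (intro exI[of _ a]) (auto simp: less_le)
qed

lemma exp_functional_eq_I:
  assumes Y: "\<forall>\<omega>\<in>space M. \<forall>t\<ge>0. Y t \<omega> = (if ennreal t < \<zeta> \<omega> then Some (X t \<omega>) else None)"
    and \<omega>: "\<omega> \<in> space M"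
  shows "exp_functional Y \<zeta> \<omega> = I \<omega>"
  unfolding exp_functional_def I_rate
  using Y \<omega> by (intro nn_integral_cong) (auto simp: rate_def indicator_def rc_eval_path)

lemma mellin_exp_functional_eq:
  assumes Y: "\<forall>\<omega>\<in>space M. \<forall>t\<ge>0. Y t \<omega> = (if ennreal t < \<zeta> \<omega> then Some (X t \<omega>) else None)"
    and mean: "laplace_exponent M Y 0 = 0 \<Longrightarrow> positive_expectation M (\<lambda>\<omega>. the (Y 1 \<omega>))"
    and cramer_finite: "\<And>z. z\<^sub>0 < z \<Longrightarrow> z < 0 \<Longrightarrow> laplace_exponent_finite M Y z"
    and theta: "0 < \<theta>" "\<theta> < - z\<^sub>0"
    and cramer_zero: "laplace_exponent M Y (- \<theta>) = 0"
    and f_analytic: "f analytic_on strip 0 (1 + \<theta>)"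
    and f_nonzero: "\<And>s. s \<in> strip 0 (1 + \<theta>) \<Longrightarrow> f s \<noteq> 0"
    and f_one: "f 1 = 1"
    and f_eq: "\<And>s :: real. 0 < s \<Longrightarrow> s < \<theta> \<Longrightarrow>
      f (complex_of_real (s + 1)) =
        - complex_of_real s * f (complex_of_real s) / complex_of_real (laplace_exponent M Y (- s))"
    and f_growth: "(\<lambda>s. inverse (cmod (f s)))
      \<in> o[at_Im_infinity_within (strip 0 (1 + \<theta>))](\<lambda>s. exp (2 * pi * \<bar>Im s\<bar>))"
    and s: "s \<in> strip 0 (1 + \<theta>)"
  shows "mellin_exp_functional M Y \<zeta> s = f s"
proof -
  have ex_a: "\<exists>a>0. laplace p 1 = ennreal a" if "0 < p" "p \<le> \<theta>" for p
    using that theta by (intro laplace_finite_of_exponent[OF Y] cramer_finite) auto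
  then have "\<forall>p. \<exists>a. 0 < p \<longrightarrow> p \<le> \<theta> \<longrightarrow> 0 < a \<and> laplace p 1 = ennreal a" by blast
  then obtain a where a: "\<And>p. 0 < p \<Longrightarrow> p \<le> \<theta> \<Longrightarrow> 0 < a p"
    "\<And>p. 0 < p \<Longrightarrow> p \<le> \<theta> \<Longrightarrow> laplace p 1 = ennreal (a p)"
    by metis
  have \<psi>: "laplace_exponent M Y (- p) = ln (a p) - q" if "0 < p" "p \<le> \<theta>" for p
    using that a by (intro laplace_exponent_eq[OF Y]) auto
  have crit: "laplace \<theta> 1 = ennreal (exp q)"
  proof -
    have "ln (a \<theta>) = q" using \<psi>[of \<theta>] cramer_zero theta by simp
    then have "a \<theta> = exp q" using a(1)[of \<theta>] theta by (metis exp_ln order_refl)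
    then show ?thesis using a(2)[of \<theta>] theta by simp
  qed
  \<comment> \<open>Without killing, X 1 = 0 almost surely would make the positive part of Y 1
    integrate to 0, whereas \<open>positive_expectation\<close> demands more than a nonnegative
    quantity.\<close>
  have nondeg: "\<not> (AE \<omega> in M. X 1 \<omega> = 0)" if "q = 0"
  proof
    assume X1: "AE \<omega> in M. X 1 \<omega> = 0"
    have "laplace 0 1 = ennreal 1" by (simp add: laplace_def emeasure_space_1)
    from laplace_exponent_eq[OF Y this] have "laplace_exponent M Y 0 = 0" using that by simp
    from mean[OF this] have pe: "positive_expectation M (\<lambda>\<omega>. the (Y 1 \<omega>))" .
    have "prob {\<omega>\<in>space M. ennreal 1 < \<zeta> \<omega>} = 1"
      using \<zeta>_tail[of 1] that by (simp add: emeasure_eq_measure)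
    from AE_prob_1[OF this] X1 have "AE \<omega> in M. the (Y 1 \<omega>) = 0"
      by eventually_elim (use Y in auto)
    then have "(\<integral>\<^sup>+\<omega>. ennreal (the (Y 1 \<omega>)) \<partial>M) = (\<integral>\<^sup>+\<omega>. 0 \<partial>M)"
      by (intro nn_integral_cong_AE) (auto elim: eventually_mono)
    then show False using pe by (simp add: positive_expectation_def)
  qed
  have neg: "ln (a p) < q" if "0 < p" "p < \<theta>" for p
    using that a[of p] by (intro laplace_exponent_neg[OF that crit nondeg]) auto
  define R where "R \<omega> = enn2real (I \<omega>)" for \<omega>
  have [measurable]: "R \<in> borel_measurable M" unfolding R_def[abs_def] by measurable
  define m where "m r = (\<integral>\<^sup>+\<omega>. ennreal (R \<omega> powr r) \<partial>M)" for r
  have finI: "AE \<omega> in M. I \<omega> < top"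
    using theta a[of "\<theta>/2"] neg[of "\<theta>/2"] by (intro I_finite[of "\<theta>/2" "a (\<theta>/2)"]) auto
  have Rpos: "AE \<omega> in M. 0 < R \<omega>"
    using finI I_pos by eventually_elim (simp add: R_def enn2real_positive_iff)
  \<comment> \<open>The midpoint of r and \<theta> is a tail exponent that exceeds r and still has
    negative Laplace exponent.\<close>
  have m_pos: "m r < top" if "0 < r" "r < \<theta>" for r
    unfolding m_def R_def using that a[of "(r + \<theta>) / 2"] neg[of "(r + \<theta>) / 2"]
    by (intro I_moment_finite[of "(r + \<theta>) / 2" "a ((r + \<theta>) / 2)"]) auto
  have m_rec: "m r = ennreal (r / (q - ln (a r))) * m (r - 1)" if "0 < r" "r < \<theta>" for r
    unfolding m_def R_def using that a[of r] neg[of r] by (intro I_moment_recurrence finI) auto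
  have m_fin: "m r < top" if "- 1 < r" "r < \<theta>" for r
  proof (cases "0 < r")
    case False
    \<comment> \<open>Here r <= 0. The recurrence at t in (0, \<theta>), with its positive factor,
      makes \<open>m (t - 1)\<close> finite, and t - 1 <= r <= 0 gives R^r <= 1 + R^(t-1). The
      minimum keeps t below \<theta>.\<close>
    define t where "t = min (r + 1) (\<theta> / 2)"
    have t: "0 < t" "t < \<theta>" "t - 1 \<le> r" using that theta by (auto simp: t_def)
    have pos: "0 < t / (q - ln (a t))" using t neg[of t] by simp
    have "ennreal (t / (q - ln (a t))) * m (t - 1) < top"
      using m_pos[OF t(1,2)] m_rec[OF t(1,2)] by simp
    then have mt: "m (t - 1) < top"
      using pos by (auto simp: ennreal_mult_less_top)
    have "m r \<le> (\<integral>\<^sup>+\<omega>. 1 + ennreal (R \<omega> powr (t - 1)) \<partial>M)"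
      unfolding m_def
    proof (rule nn_integral_mono_AE, use Rpos in eventually_elim)
      case (elim \<omega>)
      have "R \<omega> powr r \<le> 1 + R \<omega> powr (t - 1)"
      proof (cases "1 \<le> R \<omega>")
        case True
        then have "R \<omega> powr r \<le> 1" using False powr_mono[of r 0 "R \<omega>"] by simp
        then show ?thesis by (simp add: add_increasing2)
      next
        case False
        then have "R \<omega> powr r \<le> R \<omega> powr (t - 1)" using elim t by (intro powr_mono') auto
        then show ?thesis by simp
      qed
      then have "ennreal (R \<omega> powr r) \<le> ennreal (1 + R \<omega> powr (t - 1))" by (rule ennreal_leI)
      then show "ennreal (R \<omega> powr r) \<le> 1 + ennreal (R \<omega> powr (t - 1))" by simp
    qed
    also have "\<dots> = 1 + m (t - 1)"
      unfolding m_def by (subst nn_integral_add) (auto simp: emeasure_space_1)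
    also have "\<dots> < top" using mt by simp
    finally show ?thesis .
  qed (use m_pos that in auto)
  have int: "integrable M (\<lambda>\<omega>. R \<omega> powr r)" if "- 1 < r" "r < \<theta>" for r
    using m_fin[OF that] unfolding m_def by (intro integrableI_bounded) auto
  have integral: "(\<integral>\<omega>. R \<omega> powr r \<partial>M) = enn2real (m r)" for r
    unfolding m_def by (rule integral_eq_nn_integral) auto
  have "mellin_exp_functional M Y \<zeta> s = (\<integral>\<omega>. complex_of_real (R \<omega>) powr (s - 1) \<partial>M)"
    unfolding mellin_exp_functional_def
    by (intro Bochner_Integration.integral_cong refl) (simp add: exp_functional_eq_I[OF Y] R_def)
  also have "\<dots> = f s"
  proof (rule mellin_eq_of_functional_equation[OF prob_space_axioms _ Rpos theta(1) _ _
        analytic_imp_holomorphic[OF f_analytic] f_nonzero f_one f_eq f_growth s])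
    show "integrable M (\<lambda>\<omega>. R \<omega> powr (p - 1))" if "0 < p" "p < 1 + \<theta>" for p
      using that by (intro int) auto
    fix r assume r: "0 < r" "r < \<theta>"
    have \<psi>r: "laplace_exponent M Y (- r) = ln (a r) - q" using \<psi> r by simp
    have "(\<integral>\<omega>. R \<omega> powr r \<partial>M) = r / (q - ln (a r)) * (\<integral>\<omega>. R \<omega> powr (r - 1) \<partial>M)"
      unfolding integral m_rec[OF r] using r neg[OF r] by (simp add: enn2real_mult)
    also have "r / (q - ln (a r)) = - r / (ln (a r) - q)"
      by (metis minus_diff_eq minus_divide_divide)
    finally show "laplace_exponent M Y (- r) \<noteq> 0 \<and> (\<integral>\<omega>. R \<omega> powr r \<partial>M) =
        - r / laplace_exponent M Y (- r) * (\<integral>\<omega>. R \<omega> powr (r - 1) \<partial>M)"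
      unfolding \<psi>r using neg[OF r] by auto
  qed measurable
  finally show ?thesis .
qed

end

theorem proposition2:
  fixes M :: "'a measure"
    and Y :: "real \<Rightarrow> 'a \<Rightarrow> real option"
    and \<zeta> :: "'a \<Rightarrow> ennreal"
    and z\<^sub>0 \<theta> :: real
    and f :: "complex \<Rightarrow> complex"
  assumes levy: "killed_levy_process M Y \<zeta>"
    and mean: "laplace_exponent M Y 0 = 0 \<Longrightarrow> positive_expectation M (\<lambda>\<omega>. the (Y 1 \<omega>))"
    and z0: "z\<^sub>0 < 0"
    and cramer_finite: "\<And>z. z\<^sub>0 < z \<Longrightarrow> z < 0 \<Longrightarrow> laplace_exponent_finite M Y z"
    and theta: "0 < \<theta>" "\<theta> < - z\<^sub>0"
    and cramer_zero: "laplace_exponent M Y (- \<theta>) = 0"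
    and f_analytic: "f analytic_on strip 0 (1 + \<theta>)"
    and f_nonzero: "\<And>s. s \<in> strip 0 (1 + \<theta>) \<Longrightarrow> f s \<noteq> 0"
    and f_one: "f 1 = 1"
    and f_eq: "\<And>s :: real. 0 < s \<Longrightarrow> s < \<theta> \<Longrightarrow>
      f (complex_of_real (s + 1)) =
        - complex_of_real s * f (complex_of_real s) / complex_of_real (laplace_exponent M Y (- s))"
    and f_growth: "(\<lambda>s. inverse (cmod (f s)))
      \<in> o[at_Im_infinity_within (strip 0 (1 + \<theta>))](\<lambda>s. exp (2 * pi * \<bar>Im s\<bar>))"
  shows "\<forall>s \<in> strip 0 (1 + \<theta>). mellin_exp_functional M Y \<zeta> s = f s"
proof -
  obtain X q where X: "levy_process M X" "0 \<le> q" "killing_time M X q \<zeta>"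
    and Y: "\<forall>\<omega>\<in>space M. \<forall>t\<ge>0. Y t \<omega> = (if ennreal t < \<zeta> \<omega> then Some (X t \<omega>) else None)"
    using levy by (auto simp: killed_levy_process_def)
  interpret killed_levy M X q \<zeta>
    using X by (intro killed_levy.intro killed_levy_axioms.intro) (simp_all add: levy_process_def)
  show ?thesis
    using mellin_exp_functional_eq[OF Y mean cramer_finite theta cramer_zero f_analytic f_nonzero f_one f_eq f_growth]
    by blast
qed

end
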